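(* Let $\Omega\subset\mathbb{R}^n$ be a bounded measurable set, let $\mu$ be the Lebesgue measure in $\mathbb{R}^n$, let $0\le\alpha<n$, and let $p$ be a log-Hölder continuous exponent on $\Omega$ such that $1<p_*\le p(x)\le p^*<n/\alpha$ for all $x\in\Omega$. Define $q$ on $\Omega$ by $1/q(x)=1/p(x)-\alpha/n$. Let $x_0\in\Omega$ and $w(x)=|x-x_0|^{\eta}$ with $\eta\in\mathbb{R}$. If $$-\frac{n}{q(x_0)}<\eta<\frac{n}{p'(x_0)},$$ then there exists a positive constant $C$ such that $$\|w\,M_\alpha f\|_{q(\cdot),\Omega}\le C\,\|w f\|_{p(\cdot),\Omega}$$ for every function $f$ such that $wf\in L^{p(\cdot)}(\Omega)$.
   Context: $Q(x,l)$ denotes a cube in $\mathbb{R}^n$ centered at $x$ with side length $l$ and sides parallel to the coordinate axes. An exponent is a measurable function $p:\Omega\to[1,\infty)$; $p_*=\inf_\Omega p$, $p^*=\sup_\Omega p$. When $p_*>1$, $p'$ is defined by $1/p(x)+1/p'(x)=1$. An exponent $p$ is log-Hölder continuous if there is $C>0$ with $|p(x)-p(y)|\le C/\log(1/|x-y|)$ for all $x,y\in\Omega$ with $|x-y|\le 1/2$. When $\alpha=0$, $n/\alpha$ means $\infty$. For measurable $f$, $\rho_{p(\cdot),\Omega}(f)=\int_\Omega|f(x)|^{p(x)}\,d\mu(x)$ and $\|f\|_{p(\cdot),\Omega}=\inf\{\lambda>0:\rho_{p(\cdot),\Omega}(f/\lambda)\le1\}$. $L^{p(\cdot)}(\Omega)$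 is the set of measurable $f$ supported in $\Omega$ with $\|f\|_{p(\cdot),\Omega}<\infty$. Functions on $\Omega$ are extended by $0$ outside $\Omega$. The centered fractional maximal function is $$M_\alpha f(x)=\sup_{\rho>0}\frac{1}{\mu(Q(x,\rho))^{1-\alpha/n}}\int_{Q(x,\rho)}|f(y)|\,d\mu(y).$$ *)

theory Defs
  imports "HOL-Analysis.Analysis"
begin

definition cube :: "real ^ 'n \<Rightarrow> real \<Rightarrow> (real ^ 'n) set" where
  "cube x l = cbox (\<chi> i. x $ i - l / 2) (\<chi> i. x $ i + l / 2)"

text \<open>
  An exponent on \<open>\<Omega>\<close> is a total function of which only the values on \<open>\<Omega>\<close> are ever used.
\<close>

definition exponent_on :: "(real ^ 'n) set \<Rightarrow> (real ^ 'n \<Rightarrow> real) \<Rightarrow> bool" where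
  "exponent_on \<Omega> p \<longleftrightarrow> p \<in> borel_measurable (lebesgue_on \<Omega>) \<and> (\<forall>x\<in>\<Omega>. 1 \<le> p x)"

text \<open>
  Infimum and supremum are taken in the extended reals, since an exponent may be unbounded.
\<close>

definition exp_inf :: "(real ^ 'n) set \<Rightarrow> (real ^ 'n \<Rightarrow> real) \<Rightarrow> ereal" where
  "exp_inf \<Omega> p = (INF x\<in>\<Omega>. ereal (p x))"

definition exp_sup :: "(real ^ 'n) set \<Rightarrow> (real ^ 'n \<Rightarrow> real) \<Rightarrow> ereal" where
  "exp_sup \<Omega> p = (SUP x\<in>\<Omega>. ereal (p x))"

text \<open>
  For \<open>x = y\<close> the bound \<open>C / log (1 / 0)\<close> is to be read as \<open>0\<close>, so nothing is required there.
\<close>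

definition log_Hoelder_on :: "(real ^ 'n) set \<Rightarrow> (real ^ 'n \<Rightarrow> real) \<Rightarrow> bool" where
  "log_Hoelder_on \<Omega> p \<longleftrightarrow>
     (\<exists>C>0. \<forall>x\<in>\<Omega>. \<forall>y\<in>\<Omega>. x \<noteq> y \<and> norm (x - y) \<le> 1 / 2 \<longrightarrow>
        \<bar>p x - p y\<bar> \<le> C / ln (1 / norm (x - y)))"

text \<open>
  Modular and norm are defined for functions with values in \<open>[0, \<infinity>]\<close>, because a maximal function
  may take the value \<open>\<infinity>\<close>; a real-valued \<open>f\<close> enters through \<open>\<bar>f\<bar>\<close>.  The power
  \<open>ennreal_powr t r\<close> is only used with \<open>r > 0\<close>.
\<close>

definition ennreal_powr :: "ennreal \<Rightarrow> real \<Rightarrow> ennreal" where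
  "ennreal_powr t r = (if t = \<infinity> then \<infinity> else ennreal (enn2real t powr r))"

definition modular ::
    "(real ^ 'n \<Rightarrow> real) \<Rightarrow> (real ^ 'n) set \<Rightarrow> (real ^ 'n \<Rightarrow> ennreal) \<Rightarrow> ennreal" where
  "modular p \<Omega> g = (\<integral>\<^sup>+x\<in>\<Omega>. ennreal_powr (g x) (p x) \<partial>lebesgue)"

definition lux_norm ::
    "(real ^ 'n \<Rightarrow> real) \<Rightarrow> (real ^ 'n) set \<Rightarrow> (real ^ 'n \<Rightarrow> ennreal) \<Rightarrow> ennreal" where
  "lux_norm p \<Omega> g = (INF l\<in>{l :: real. 0 < l \<and> modular p \<Omega> (\<lambda>x. g x / ennreal l) \<le> 1}. ennreal l)"

definition Lp_var ::
    "(real ^ 'n \<Rightarrow> real) \<Rightarrow> (real ^ 'n) set \<Rightarrow> (real ^ 'n \<Rightarrow> real) set" where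
  "Lp_var p \<Omega> = {f. f \<in> borel_measurable lebesgue \<and> (\<forall>x. x \<notin> \<Omega> \<longrightarrow> f x = 0) \<and>
     lux_norm p \<Omega> (\<lambda>x. ennreal \<bar>f x\<bar>) < \<infinity>}"

definition frac_maximal :: "real \<Rightarrow> (real ^ 'n \<Rightarrow> real) \<Rightarrow> real ^ 'n \<Rightarrow> ennreal" where
  "frac_maximal \<alpha> f x =
     (SUP r\<in>{0<..}. (\<integral>\<^sup>+y\<in>cube x r. ennreal \<bar>f y\<bar> \<partial>lebesgue) /
        ennreal (measure lebesgue (cube x r) powr (1 - \<alpha> / real CARD('n))))"

text \<open>
  At \<open>x = x0\<close> this is \<open>0\<close> for every \<open>\<eta>\<close> (as \<open>0 powr \<eta> = 0\<close>), whereas \<open>\<bar>x - x0\<bar>\<^sup>\<eta>\<close> would be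
  \<open>1\<close> or \<open>\<infinity>\<close> there when \<open>\<eta> \<le> 0\<close>; a single point is a null set and affects no modular.
\<close>

definition power_weight :: "real ^ 'n \<Rightarrow> real \<Rightarrow> real ^ 'n \<Rightarrow> real" where
  "power_weight x0 \<eta> x = norm (x - x0) powr \<eta>"

end

theory Submission
  imports Defs
begin

text \<open>
  By homogeneity it suffices to bound \<open>\<integral>\<^sub>\<Omega> (w M\<^sub>\<alpha> f)\<^sup>q\<close> by a constant when \<open>g = w \<bar>f\<bar>\<close> satisfies
  \<open>\<integral>\<^sub>\<Omega> g\<^sup>p \<le> 1\<close>.  Cubes may be replaced by balls.  Fix \<open>x \<noteq> x\<^sub>0\<close>, put \<open>d = \<bar>x - x\<^sub>0\<bar>\<close> and separate the radii
  below and above \<open>d / 2\<close>.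

  On a ball of radius \<open>r < d / 2\<close> around \<open>x\<close> the weight is comparable to \<open>w x\<close>, so only the unweighted
  fractional averages of \<open>g\<close> matter.  Here log-Hoelder continuity enters through a Jensen inequality
  with variable exponent (\<open>set_integral_le_modular_average\<close>): for \<open>1 \<le> s \<le> p\<close> and \<open>h = g\<^bsup>p/s\<^esup>\<close>, the average
  of \<open>g\<close> over a small set near \<open>x\<close> is at most a constant times \<open>(1 + average of h)\<^bsup>s/p(x)\<^esup>\<close>.  It is used
  twice.  With a fixed \<open>1 < s \<le> inf p\<close> it gives \<open>(1 + M h x)\<^bsup>s/p(x)\<^esup>\<close>, and with \<open>s = 1\<close> it gives
  \<open>r\<^bsup>-n/p(x)\<^esup>\<close>.  Interpolating between the two bounds as in Hedberg's inequality cancels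
  \<open>r\<^sup>\<alpha>\<close> and leaves \<open>(1 + M h x)\<^bsup>s/q(x)\<^esup>\<close> (\<open>local_fractional_average_le\<close>).  Its \<open>q(x)\<close>-th power is
  integrable because \<open>h\<^sup>s = g\<^sup>p\<close> is, by the maximal theorem in \<open>L\<^sup>s\<close>
  (\<open>HL_maximal_strong_type\<close>, proved from the Vitali covering lemma).

  A ball of radius \<open>\<rho> \<ge> d / 2\<close> around \<open>x\<close> lies in the ball of radius \<open>3 \<rho>\<close> around \<open>x\<^sub>0\<close>, which leaves a
  Hardy operator centred at \<open>x\<^sub>0\<close>.  Cut \<open>\<Omega>\<close> into dyadic shells of radius \<open>R\<^sub>k\<close> around \<open>x\<^sub>0\<close>.  The Jensen
  inequality at \<open>x\<^sub>0\<close> with \<open>s = 1\<close> bounds the integral of \<open>g\<close> over the \<open>k\<close>-th shell by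
  \<open>R\<^sub>k\<^bsup>n-n/p(x0)\<^esup> u\<^sub>k\<^bsup>1/p(x0)\<^esup>\<close>, where \<open>u\<^sub>k\<close> is the modular of the shell plus a multiple of \<open>R\<^sub>k\<^sup>n\<close>,
  so that \<open>\<Sum>\<^sub>k u\<^sub>k\<close> is bounded.  By the two strict inequalities for \<open>\<eta>\<close>, the contribution of
  the \<open>k\<close>-th shell to a point of the \<open>j\<close>-th shell decays geometrically in \<open>\<bar>j - k\<bar>\<close>.  Hence the operator
  is at most \<open>R\<^sub>j\<^bsup>-n/q(x0)\<^esup> v\<^sub>j\<^bsup>1/p(x0)\<^esup>\<close> on the \<open>j\<close>-th shell, \<open>v\<close> being the convolution of \<open>u\<close> with a
  summable kernel (\<open>global_fractional_average_le\<close>).  Since \<open>R\<^sub>j\<^sup>n \<le> v\<^sub>j\<close> and \<open>v\<close> is bounded, log-Hoelder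
  continuity at \<open>x\<^sub>0\<close> allows \<open>q(x)\<close> to be exchanged for \<open>q(x\<^sub>0)\<close>: the \<open>q(x)\<close>-th power is at most a
  constant times \<open>R\<^sub>j\<^bsup>-n\<^esup> v\<^sub>j\<close>, whose integral over the shells is at most a constant times
  \<open>\<Sum>\<^sub>j v\<^sub>j\<close>.
\<close>

section \<open>The Hardy--Littlewood maximal function\<close>

lemma less_divide_ennreal:
  fixes a b c :: ennreal
  assumes "b \<noteq> 0" "b < top"
  shows "c < a / b \<longleftrightarrow> c * b < a"
  using assms
  by (cases a; cases b; cases c)
     (auto simp: divide_ennreal ennreal_mult[symmetric] ennreal_less_iff field_simps ennreal_top_mult ennreal_top_divide)

lemma emeasure_lebesgue_ball:
  fixes x :: "'a::euclidean_space"
  assumes "0 \<le> r"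
  shows "emeasure lebesgue (ball x r) = ennreal (unit_ball_vol (real DIM('a)) * r ^ DIM('a))"
  using assms by (simp add: emeasure_ball)

text \<open>
  Bounding the radii by \<open>R\<close> makes the covering lemma applicable; all bounds below are uniform in \<open>R\<close>.
\<close>

definition HL_maximal :: "real \<Rightarrow> ('a::euclidean_space \<Rightarrow> ennreal) \<Rightarrow> 'a \<Rightarrow> ennreal" where
  "HL_maximal R h x =
     (SUP r\<in>{0<..<R}. (\<integral>\<^sup>+y\<in>ball x r. h y \<partial>lebesgue) / emeasure lebesgue (ball x r))"

lemma HL_maximal_gt_iff:
  fixes x :: "'a::euclidean_space"
  shows "c < HL_maximal R h x \<longleftrightarrow>
    (\<exists>r. 0 < r \<and> r < R \<and> c * emeasure lebesgue (ball x r) < (\<integral>\<^sup>+y\<in>ball x r. h y \<partial>lebesgue))"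
proof -
  have "c < (\<integral>\<^sup>+y\<in>ball x r. h y \<partial>lebesgue) / emeasure lebesgue (ball x r) \<longleftrightarrow>
      c * emeasure lebesgue (ball x r) < (\<integral>\<^sup>+y\<in>ball x r. h y \<partial>lebesgue)" if "0 < r" for r
    by (rule less_divide_ennreal) (use that in \<open>simp_all only: emeasure_lebesgue_ball less_imp_le\<close>, simp_all add: less_imp_neq[symmetric])
  then show ?thesis
    unfolding HL_maximal_def less_SUP_iff by auto
qed

lemma average_le_HL_maximal:
  fixes x :: "'a::euclidean_space"
  assumes "0 < r" "r < R"
  shows "(\<integral>\<^sup>+y\<in>ball x r. h y \<partial>lebesgue) \<le> HL_maximal R h x * emeasure lebesgue (ball x r)"
  using HL_maximal_gt_iff[of "HL_maximal R h x" R h x] assms by (meson less_irrefl not_le)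

text \<open>
  Lower semicontinuity: an average that exceeds \<open>c\<close> on a ball still does so on a slightly smaller
  concentric ball, and that ball is contained in every translate of the original one by a small vector.
\<close>

lemma open_HL_maximal_gt:
  fixes h :: "'a::euclidean_space \<Rightarrow> ennreal"
  assumes h[measurable]: "h \<in> borel_measurable lebesgue"
  shows "open {x. c < HL_maximal R h x}"
proof (rule openI, clarify)
  fix x assume "c < HL_maximal R h x"
  then obtain r where r: "0 < r" "r < R"
    and gt: "c * emeasure lebesgue (ball x r) < (\<integral>\<^sup>+y\<in>ball x r. h y \<partial>lebesgue)"
    unfolding HL_maximal_gt_iff by auto
  define \<nu> where "\<nu> = density lebesgue h"
  have \<nu>: "emeasure \<nu> (ball y s) = (\<integral>\<^sup>+z\<in>ball y s. h z \<partial>lebesgue)" for y s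
    unfolding \<nu>_def by (rule emeasure_density) auto
  define B where "B m = ball x (r - r / Suc m)" for m :: nat
  have "incseq B"
    unfolding B_def incseq_def using r
    by (intro allI impI subset_ball) (auto simp: frac_le)
  moreover have "range B \<subseteq> sets \<nu>"
    unfolding B_def \<nu>_def by auto
  ultimately have "(SUP m. emeasure \<nu> (B m)) = emeasure \<nu> (\<Union>m. B m)"
    by (intro SUP_emeasure_incseq)
  also have "(\<Union>m. B m) = ball x r"
  proof
    show "(\<Union>m. B m) \<subseteq> ball x r"
      unfolding B_def using r by (auto intro!: less_le_trans[of _ "r - r / _" r])
    show "ball x r \<subseteq> (\<Union>m. B m)"
    proof
      fix y assume "y \<in> ball x r"
      then have "0 < (r - dist x y) / r" using r by simp
      then obtain m where "inverse (real (Suc m)) < (r - dist x y) / r"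
        using reals_Archimedean by blast
      then have "y \<in> B m" using r by (simp add: B_def field_simps)
      then show "y \<in> (\<Union>m. B m)" by blast
    qed
  qed
  finally have "c * emeasure lebesgue (ball x r) < (SUP m. emeasure \<nu> (B m))"
    using gt by (simp add: \<nu>)
  then obtain m where m: "c * emeasure lebesgue (ball x r) < emeasure \<nu> (B m)"
    unfolding less_SUP_iff by auto
  have "c < HL_maximal R h y" if "y \<in> ball x (r / Suc m)" for y
  proof -
    have "B m \<subseteq> ball y r"
    proof
      fix z assume "z \<in> B m"
      with that show "z \<in> ball y r"
        using dist_triangle[of y z x] by (simp add: B_def dist_commute)
    qed
    then have "emeasure \<nu> (B m) \<le> emeasure \<nu> (ball y r)"
      by (intro emeasure_mono) (auto simp: \<nu>_def)
    with m have "c * emeasure lebesgue (ball x r) < emeasure \<nu> (ball y r)" by (rule less_le_trans)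
    moreover have "emeasure lebesgue (ball x r) = emeasure lebesgue (ball y r)"
      using r by (simp only: emeasure_lebesgue_ball)
    ultimately show ?thesis
      unfolding HL_maximal_gt_iff \<nu> using r by auto
  qed
  then show "\<exists>T. 0 < T \<and> ball x T \<subseteq> {x. c < HL_maximal R h x}"
    using r by (intro exI[of _ "r / Suc m"]) auto
qed

lemma borel_measurable_HL_maximal [measurable]:
  fixes h :: "'a::euclidean_space \<Rightarrow> ennreal"
  assumes "h \<in> borel_measurable lebesgue"
  shows "HL_maximal R h \<in> borel_measurable lebesgue"
  by (rule borel_measurableI_greater) (use open_HL_maximal_gt[OF assms] in \<open>simp add: sets_completionI_sets\<close>)

text \<open>
  Each point of the superlevel set is the centre of a ball on which the average exceeds \<open>t\<close>.  The Vitali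
  lemma selects disjoint balls among these whose fivefold dilations still cover the set.
\<close>

lemma HL_maximal_weak_type:
  fixes h :: "'a::euclidean_space \<Rightarrow> ennreal"
  assumes h[measurable]: "h \<in> borel_measurable lebesgue" and t: "0 < t"
  shows "ennreal t * emeasure lebesgue {x. ennreal t < HL_maximal R h x}
           \<le> 5 ^ DIM('a) * (\<integral>\<^sup>+y. h y \<partial>lebesgue)"
proof -
  define E where "E = {x. ennreal t < HL_maximal R h x}"
  define \<nu> where "\<nu> = density lebesgue h"
  have \<nu>: "emeasure \<nu> A = (\<integral>\<^sup>+z\<in>A. h z \<partial>lebesgue)" if "A \<in> sets lebesgue" for A
    unfolding \<nu>_def by (rule emeasure_density) (use that in auto)
  have "\<forall>x\<in>E. \<exists>r. 0 < r \<and> r < R \<and>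
      ennreal t * emeasure lebesgue (ball x r) < (\<integral>\<^sup>+y\<in>ball x r. h y \<partial>lebesgue)"
    unfolding E_def HL_maximal_gt_iff by auto
  then obtain r where r: "\<And>x. x \<in> E \<Longrightarrow> 0 < r x \<and> r x < R"
    and gt: "\<And>x. x \<in> E \<Longrightarrow> ennreal t * emeasure lebesgue (ball x (r x)) < \<nu> (ball x (r x))"
    unfolding bchoice_iff by (auto simp: \<nu>)
  have cover: "E \<subseteq> (\<Union>x\<in>E. cball x (r x))"
    using r by (auto intro!: bexI simp: less_imp_le)
  have r': "\<And>x. x \<in> E \<Longrightarrow> 0 < r x \<and> r x \<le> R" using r by fastforce
  obtain C where C: "countable C" "C \<subseteq> E"
     and disj: "pairwise (\<lambda>i j. disjnt (cball i (r i)) (cball j (r j))) C"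
     and cov: "E \<subseteq> (\<Union>i\<in>C. cball i (5 * r i))"
    by (rule Vitali_covering_lemma_cballs[OF cover r'])
  have disj': "disjoint_family_on (\<lambda>x. ball x (r x)) C"
    using disj ball_subset_cball unfolding disjoint_family_on_def pairwise_def disjnt_def by blast
  have five: "ennreal t * emeasure lebesgue (cball x (5 * r x)) \<le> 5 ^ DIM('a) * \<nu> (ball x (r x))"
    if "x \<in> C" for x
  proof -
    have x: "x \<in> E" using that C by auto
    have "emeasure lebesgue (cball x (5 * r x)) = 5 ^ DIM('a) * emeasure lebesgue (ball x (r x))"
      using r[OF x]
      by (simp add: emeasure_cball emeasure_ball power_mult_distrib ennreal_mult' ennreal_power[symmetric] ac_simps)
    then have "ennreal t * emeasure lebesgue (cball x (5 * r x))
        = 5 ^ DIM('a) * (ennreal t * emeasure lebesgue (ball x (r x)))"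
      by (simp add: ac_simps)
    also have "\<dots> \<le> 5 ^ DIM('a) * \<nu> (ball x (r x))"
      by (intro mult_left_mono less_imp_le[OF gt[OF x]]) auto
    finally show ?thesis .
  qed
  have "emeasure lebesgue E \<le> emeasure lebesgue (\<Union>x\<in>C. cball x (5 * r x))"
    using cov C by (intro emeasure_mono sets.countable_UN') auto
  also have "\<dots> \<le> (\<integral>\<^sup>+x. emeasure lebesgue (cball x (5 * r x)) \<partial>count_space C)"
  proof -
    have "emeasure lebesgue (\<Union>x\<in>C. cball x (5 * r x)) =
        (\<integral>\<^sup>+y. indicator (\<Union>x\<in>C. cball x (5 * r x)) y \<partial>lebesgue)"
      using C by (intro nn_integral_indicator[symmetric] sets.countable_UN') auto
    also have "\<dots> \<le> (\<integral>\<^sup>+y. (\<integral>\<^sup>+x. indicator (cball x (5 * r x)) y \<partial>count_space C) \<partial>lebesgue)"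
    proof (rule nn_integral_mono)
      fix y :: 'a
      show "indicator (\<Union>x\<in>C. cball x (5 * r x)) y \<le>
          (\<integral>\<^sup>+x. (indicator (cball x (5 * r x)) y :: ennreal) \<partial>count_space C)"
      proof (cases "y \<in> (\<Union>x\<in>C. cball x (5 * r x))")
        case True
        then obtain x where x: "x \<in> C" "y \<in> cball x (5 * r x)" by auto
        have "(1::ennreal) = (\<integral>\<^sup>+z. indicator {x} z \<partial>count_space C)"
          using x by (subst nn_integral_indicator) auto
        also have "\<dots> \<le> (\<integral>\<^sup>+z. (indicator (cball z (5 * r z)) y :: ennreal) \<partial>count_space C)"
          using x by (intro nn_integral_mono) (auto split: split_indicator)
        finally show ?thesis using True by simp
      qed simp
    qed
    also have "\<dots> = (\<integral>\<^sup>+x. (\<integral>\<^sup>+y. indicator (cball x (5 * r x)) y \<partial>lebesgue) \<partial>count_space C)"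
      using C by (intro nn_integral_count_space_nn_integral) (auto intro!: borel_measurable_indicator)
    finally show ?thesis by simp
  qed
  finally have "ennreal t * emeasure lebesgue E
      \<le> ennreal t * (\<integral>\<^sup>+x. emeasure lebesgue (cball x (5 * r x)) \<partial>count_space C)"
    by (rule mult_left_mono) auto
  also have "\<dots> = (\<integral>\<^sup>+x. ennreal t * emeasure lebesgue (cball x (5 * r x)) \<partial>count_space C)"
    by (simp add: nn_integral_cmult)
  also have "\<dots> \<le> (\<integral>\<^sup>+x. 5 ^ DIM('a) * \<nu> (ball x (r x)) \<partial>count_space C)"
    by (intro nn_integral_mono) (use five in auto)
  also have "\<dots> = 5 ^ DIM('a) * (\<integral>\<^sup>+x. \<nu> (ball x (r x)) \<partial>count_space C)"
    by (simp add: nn_integral_cmult)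
  also have "(\<integral>\<^sup>+x. \<nu> (ball x (r x)) \<partial>count_space C) = emeasure \<nu> (\<Union>x\<in>C. ball x (r x))"
    using C disj' by (intro emeasure_UN_countable[symmetric]) (auto simp: \<nu>_def)
  also have "5 ^ DIM('a) * emeasure \<nu> (\<Union>x\<in>C. ball x (r x)) \<le> 5 ^ DIM('a) * emeasure \<nu> UNIV"
    using C by (intro mult_left_mono emeasure_mono) (auto simp: \<nu>_def)
  also have "\<nu> UNIV = (\<integral>\<^sup>+y. h y \<partial>lebesgue)" by (simp add: \<nu>)
  finally show ?thesis unfolding E_def .
qed

text \<open>
  The part of \<open>h\<close> below \<open>t / 2\<close> contributes at most \<open>t / 2\<close> to every average, so the weak type bound may
  be applied to the part above \<open>t / 2\<close> alone.  This is the input of the Marcinkiewicz argument.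
\<close>

lemma HL_maximal_truncated_weak_type:
  fixes h :: "'a::euclidean_space \<Rightarrow> ennreal"
  assumes h[measurable]: "h \<in> borel_measurable lebesgue" and t: "0 < t"
  shows "ennreal t * emeasure lebesgue {x. ennreal t < HL_maximal R h x}
           \<le> 2 * 5 ^ DIM('a) * (\<integral>\<^sup>+y. h y * indicator {y. ennreal (t / 2) < h y} y \<partial>lebesgue)"
proof -
  define k where "k y = h y * indicator {y. ennreal (t / 2) < h y} y" for y
  have [measurable]: "k \<in> borel_measurable lebesgue"
    unfolding k_def by measurable
  have "ennreal (t / 2) < HL_maximal R k x" if "ennreal t < HL_maximal R h x" for x
  proof -
    from that obtain r where r: "0 < r" "r < R"
      and gt: "ennreal t * emeasure lebesgue (ball x r) < (\<integral>\<^sup>+y\<in>ball x r. h y \<partial>lebesgue)"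
      unfolding HL_maximal_gt_iff by auto
    define V where "V = emeasure lebesgue (ball x r)"
    have V: "V < top"
      unfolding V_def using r by (simp only: emeasure_lebesgue_ball less_imp_le ennreal_less_top)
    have split: "ennreal t * V = ennreal (t / 2) * V + ennreal (t / 2) * V"
      using t by (simp add: distrib_right[symmetric] ennreal_plus[symmetric] del: ennreal_plus)
    have "(\<integral>\<^sup>+y\<in>ball x r. h y \<partial>lebesgue)
        \<le> (\<integral>\<^sup>+y. k y * indicator (ball x r) y + ennreal (t / 2) * indicator (ball x r) y \<partial>lebesgue)"
      by (intro nn_integral_mono) (auto simp: k_def split: split_indicator)
    also have "\<dots> = (\<integral>\<^sup>+y\<in>ball x r. k y \<partial>lebesgue) + ennreal (t / 2) * V"
    proof -
      have [measurable]: "ball x r \<in> sets lebesgue" by simp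
      show ?thesis by (subst nn_integral_add) (simp_all add: V_def nn_integral_cmult_indicator)
    qed
    finally have "ennreal (t / 2) * V + ennreal (t / 2) * V
        < (\<integral>\<^sup>+y\<in>ball x r. k y \<partial>lebesgue) + ennreal (t / 2) * V"
      using gt unfolding V_def[symmetric] split by order
    then have "ennreal (t / 2) * V < (\<integral>\<^sup>+y\<in>ball x r. k y \<partial>lebesgue)"
      by (meson add_right_mono not_le)
    then show ?thesis
      using r unfolding HL_maximal_gt_iff V_def by auto
  qed
  then have sub: "{x. ennreal t < HL_maximal R h x} \<subseteq> {x. ennreal (t / 2) < HL_maximal R k x}"
    by auto
  have "emeasure lebesgue {x. ennreal t < HL_maximal R h x}
      \<le> emeasure lebesgue {x. ennreal (t / 2) < HL_maximal R k x}"
    by (intro emeasure_mono sub sets_completionI_sets) (auto intro!: borel_open open_HL_maximal_gt)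
  then have "ennreal t * emeasure lebesgue {x. ennreal t < HL_maximal R h x}
      \<le> 2 * (ennreal (t / 2) * emeasure lebesgue {x. ennreal (t / 2) < HL_maximal R k x})"
    using t by (simp add: mult.assoc[symmetric] mult_left_mono flip: ennreal_numeral ennreal_mult)
  also have "\<dots> \<le> 2 * (5 ^ DIM('a) * (\<integral>\<^sup>+y. k y \<partial>lebesgue))"
    by (intro mult_left_mono HL_maximal_weak_type) (use t in auto)
  finally show ?thesis by (simp add: k_def mult.assoc)
qed

lemma sum_dyadic_powers_below:
  fixes y s :: real
  assumes s: "1 < s" and y: "0 \<le> y"
  shows "(\<Sum>k<N. 2 powr (real k * (s - 1)) * of_bool (2 ^ k < y))
    \<le> 2 powr (s - 1) / (2 powr (s - 1) - 1) * y powr (s - 1)"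
proof (induction N)
  case 0
  have "1 < 2 powr (s - 1)" using s by simp
  then show ?case by simp
next
  case (Suc N)
  define b where "b = 2 powr (s - 1)"
  have b: "1 < b" using s by (simp add: b_def)
  have pow: "2 powr (real k * (s - 1)) = b ^ k" for k
    by (simp add: b_def powr_realpow[symmetric] powr_powr mult.commute)
  show ?case
  proof (cases "2 ^ N < y")
    case True
    have "(\<Sum>k<Suc N. 2 powr (real k * (s - 1)) * of_bool (2 ^ k < y)) = (\<Sum>k<Suc N. b ^ k)"
    proof (intro sum.cong refl)
      fix k assume "k \<in> {..<Suc N}"
      then have "(2::real) ^ k \<le> 2 ^ N" by (intro power_increasing) auto
      with True have "2 ^ k < y" by linarith
      then show "2 powr (real k * (s - 1)) * of_bool (2 ^ k < y) = b ^ k" by (simp add: pow)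
    qed
    also have "\<dots> = (b ^ Suc N - 1) / (b - 1)"
      using b geometric_sum[of b "Suc N"] by simp
    also have "\<dots> \<le> b / (b - 1) * b ^ N"
      using b by (simp add: divide_right_mono)
    also have "b ^ N = (2 ^ N) powr (s - 1)"
      by (simp add: b_def powr_realpow[symmetric] powr_powr mult.commute)
    also have "b / (b - 1) * (2 ^ N) powr (s - 1) \<le> b / (b - 1) * y powr (s - 1)"
      using b True s by (intro mult_left_mono powr_mono2) auto
    finally show ?thesis by (simp add: b_def)
  next
    case False
    then show ?thesis using Suc by simp
  qed
qed

text \<open>
  A discrete layer-cake formula.  Levels below \<open>1\<close> are absorbed by the summand \<open>1\<close>, which on a set of
  finite measure is harmless and lets the sum range over natural numbers.
\<close>

lemma ennreal_powr_le_dyadic_levels: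
  assumes s: "0 < s"
  shows "ennreal_powr z s
    \<le> 1 + (\<Sum>k. ennreal (2 powr (real (Suc k) * s)) * indicator {z. ennreal (2 ^ k) < z} z)"
    (is "_ \<le> 1 + (\<Sum>k. ?f k)")
proof (cases z)
  case top
  have "of_nat N \<le> (\<Sum>k. ?f k)" for N
  proof -
    have "of_nat N = (\<Sum>k<N. (1::ennreal))" by simp
    also have "\<dots> \<le> (\<Sum>k<N. ?f k)"
    proof (rule sum_mono)
      fix k
      have "1 \<le> 2 powr (real (Suc k) * s)" using s by (intro ge_one_powr_ge_zero) auto
      then show "1 \<le> ?f k" using top by (simp add: less_top)
    qed
    also have "\<dots> \<le> (\<Sum>k. ?f k)" by (intro sum_le_suminf) auto
    finally show ?thesis .
  qed
  then have "(\<Sum>k. ?f k) = top"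
    by (meson ennreal_Ex_less_of_nat not_le top.not_eq_extremum)
  then show ?thesis by simp
next
  case (real v)
  show ?thesis
  proof (cases "v \<le> 1")
    case True
    then have "v powr s \<le> 1" using real s powr_mono2[of s v 1] by simp
    then have "ennreal (v powr s) \<le> 1" by simp
    also have "1 \<le> 1 + (\<Sum>k. ?f k)" by simp
    finally show ?thesis using real by (simp add: ennreal_powr_def)
  next
    case False
    obtain N where N: "v < 2 ^ N" using real_arch_pow[of 2 v] by auto
    define m where "m = (LEAST m. v \<le> 2 ^ m)"
    have m: "v \<le> 2 ^ m" unfolding m_def by (rule LeastI[of _ N]) (use N in simp)
    then have "m \<noteq> 0" using False by (auto intro: ccontr)
    then obtain k where k: "m = Suc k" by (cases m) auto
    have "\<not> v \<le> 2 ^ k"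
      using not_less_Least[of k "\<lambda>m. v \<le> 2 ^ m"] k unfolding m_def by auto
    then have less: "2 ^ k < v" by simp
    have "v powr s \<le> (2 ^ Suc k) powr s"
      using m k s real by (intro powr_mono2) auto
    also have "\<dots> = 2 powr (real (Suc k) * s)"
      by (simp only: powr_realpow[symmetric] powr_powr zero_less_numeral)
    finally have "ennreal (v powr s) \<le> ?f k"
      using real less by (simp add: ennreal_less_iff ennreal_leI)
    also have "\<dots> \<le> (\<Sum>k. ?f k)"
      using sum_le_suminf[of ?f "{k}", OF summableI] by (simp only: finite.intros sum.insert_if sum.empty) simp
    also have "\<dots> \<le> 1 + (\<Sum>k. ?f k)" by (simp add: add_increasing)
    finally show ?thesis using real by (simp add: ennreal_powr_def)
  qed
qed

text \<open>
  Marcinkiewicz interpolation with dyadic levels: insert the truncated weak type bound into the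
  layer-cake sum and exchange sum and integral.  For each \<open>y\<close> only the levels below \<open>2 h y\<close> survive, and
  since \<open>s > 1\<close> their geometric sum is dominated by its largest term.
\<close>

lemma HL_maximal_strong_type:
  assumes s: "1 < s"
  shows "\<exists>K\<ge>0. \<forall>R E h. h \<in> borel_measurable lebesgue \<longrightarrow> (\<forall>y. 0 \<le> h y) \<longrightarrow> E \<in> sets lebesgue \<longrightarrow>
      (\<integral>\<^sup>+x\<in>E. ennreal_powr (HL_maximal R (\<lambda>y. ennreal (h y)) x) s \<partial>lebesgue)
        \<le> emeasure lebesgue E
           + ennreal K * (\<integral>\<^sup>+y. ennreal (h y powr s) \<partial>(lebesgue :: 'a::euclidean_space measure))"
proof -
  define c where "c = 2 powr (s - 1) / (2 powr (s - 1) - 1)"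
  have "1 < 2 powr (s - 1)" using s by simp
  then have c: "0 \<le> c" unfolding c_def by (intro divide_nonneg_nonneg) auto
  define K where "K = 4 powr s * 5 ^ DIM('a) * c"
  have K0: "0 \<le> K" using c by (simp add: K_def)
  have "(\<integral>\<^sup>+x\<in>E. ennreal_powr (HL_maximal R (\<lambda>y. ennreal (h y)) x) s \<partial>lebesgue)
        \<le> emeasure lebesgue E + ennreal K * (\<integral>\<^sup>+y. ennreal (h y powr s) \<partial>lebesgue)"
    if h[measurable]: "h \<in> borel_measurable lebesgue" and h0: "\<And>y. 0 \<le> h y"
      and E[measurable]: "E \<in> sets lebesgue"
    for R :: real and E :: "'a set" and h :: "'a \<Rightarrow> real"
  proof -
  define Z where "Z = HL_maximal R (\<lambda>y. ennreal (h y))"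
  have Z[measurable]: "Z \<in> borel_measurable lebesgue"
    unfolding Z_def by measurable
  have level_sets: "{x. c < Z x} \<in> sets lebesgue" for c
    unfolding Z_def by (intro sets_completionI_sets) (auto intro!: borel_open open_HL_maximal_gt)
  define I where "I k = (\<integral>\<^sup>+y. ennreal (h y) * indicator {y. 2 ^ k / 2 < h y} y \<partial>lebesgue)" for k :: nat
  have level: "ennreal (2 powr (real (Suc k) * s)) * emeasure lebesgue {x. ennreal (2 ^ k) < Z x}
      \<le> ennreal (2 * 2 powr s * 5 ^ DIM('a)) * (ennreal (2 powr (real k * (s - 1))) * I k)" for k
  proof -
    have "2 powr (real (Suc k) * s) = 2 powr s * 2 powr (real k * (s - 1)) * 2 ^ k"
      by (simp add: powr_realpow[symmetric] powr_add[symmetric] algebra_simps)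
    then have "ennreal (2 powr (real (Suc k) * s)) * emeasure lebesgue {x. ennreal (2 ^ k) < Z x}
      = ennreal (2 powr s * 2 powr (real k * (s - 1))) *
         (ennreal (2 ^ k) * emeasure lebesgue {x. ennreal (2 ^ k) < Z x})"
      by (simp only: ennreal_mult' mult.assoc powr_ge_zero zero_le_power zero_le_mult_iff ennreal_mult''
          zero_le_numeral)
    also have "\<dots> \<le> ennreal (2 powr s * 2 powr (real k * (s - 1))) * (2 * 5 ^ DIM('a) * I k)"
      using HL_maximal_truncated_weak_type[of "\<lambda>y. ennreal (h y)" "2 ^ k" R] h0
      unfolding Z_def I_def by (intro mult_left_mono) (auto simp: ennreal_less_iff)
    also have "\<dots> = ennreal (2 * 2 powr s * 5 ^ DIM('a)) * (ennreal (2 powr (real k * (s - 1))) * I k)"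
      by (simp add: ennreal_mult' ennreal_power[symmetric] ac_simps)
    finally show ?thesis .
  qed
  \<comment> \<open>Only the unit summand is restricted to \<open>E\<close>; the level sets are counted in the whole space.\<close>
  have "(\<integral>\<^sup>+x\<in>E. ennreal_powr (Z x) s \<partial>lebesgue)
     \<le> (\<integral>\<^sup>+x. indicator E x + (\<Sum>k. ennreal (2 powr (real (Suc k) * s)) *
            indicator {x. ennreal (2 ^ k) < Z x} x) \<partial>lebesgue)"
  proof (intro nn_integral_mono)
    fix x
    show "ennreal_powr (Z x) s * indicator E x \<le> indicator E x + (\<Sum>k. ennreal (2 powr (real (Suc k) * s)) *
            indicator {x. ennreal (2 ^ k) < Z x} x)"
      using ennreal_powr_le_dyadic_levels[of s "Z x"] s unfolding indicator_def by simp
  qed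
  also have "\<dots> = emeasure lebesgue E + (\<Sum>k. ennreal (2 powr (real (Suc k) * s)) *
            emeasure lebesgue {x. ennreal (2 ^ k) < Z x})"
    by (subst nn_integral_add) (simp_all add: nn_integral_suminf nn_integral_cmult_indicator level_sets del: emeasure_completion)
  also have "\<dots> \<le> emeasure lebesgue E + (\<Sum>k. ennreal (2 * 2 powr s * 5 ^ DIM('a)) * (ennreal (2 powr (real k * (s - 1))) * I k))"
    by (intro add_left_mono suminf_le level) auto
  also have "(\<Sum>k. ennreal (2 * 2 powr s * 5 ^ DIM('a)) * (ennreal (2 powr (real k * (s - 1))) * I k))
     = ennreal (2 * 2 powr s * 5 ^ DIM('a)) * (\<integral>\<^sup>+y. (\<Sum>k. ennreal (2 powr (real k * (s - 1))) *
          (ennreal (h y) * indicator {y. 2 ^ k / 2 < h y} y)) \<partial>lebesgue)"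
    by (simp add: I_def nn_integral_suminf nn_integral_cmult)
  also have "\<dots> \<le> ennreal (2 * 2 powr s * 5 ^ DIM('a)) * (\<integral>\<^sup>+y. ennreal (c * 2 powr (s - 1)) * ennreal (h y powr s) \<partial>lebesgue)"
  proof (intro mult_left_mono nn_integral_mono)
    fix y
    have "(\<Sum>k. ennreal (2 powr (real k * (s - 1))) * (ennreal (h y) * indicator {y. 2 ^ k / 2 < h y} y))
      \<le> ennreal (h y * (c * (2 * h y) powr (s - 1)))"
    proof (rule suminf_le_const)
      fix N
      have "(\<Sum>k<N. ennreal (2 powr (real k * (s - 1))) * (ennreal (h y) * indicator {y. 2 ^ k / 2 < h y} y))
         = ennreal (h y * (\<Sum>k<N. 2 powr (real k * (s - 1)) * of_bool (2 ^ k < 2 * h y)))"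
        unfolding sum_distrib_left
        by (subst sum_ennreal[symmetric])
           (auto intro!: sum.cong simp: h0 ennreal_mult' mult.commute field_simps split: split_indicator)
      also have "\<dots> \<le> ennreal (h y * (c * (2 * h y) powr (s - 1)))"
        unfolding c_def using s h0
        by (intro ennreal_leI mult_left_mono sum_dyadic_powers_below) auto
      finally show "(\<Sum>k<N. ennreal (2 powr (real k * (s - 1))) * (ennreal (h y) * indicator {y. 2 ^ k / 2 < h y} y))
        \<le> ennreal (h y * (c * (2 * h y) powr (s - 1)))" .
    qed auto
    also have "h y * (c * (2 * h y) powr (s - 1)) = c * 2 powr (s - 1) * h y powr s"
      using h0[of y] s by (cases "h y = 0") (auto simp: powr_mult powr_diff)
    finally show "(\<Sum>k. ennreal (2 powr (real k * (s - 1))) * (ennreal (h y) * indicator {y. 2 ^ k / 2 < h y} y))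
      \<le> ennreal (c * 2 powr (s - 1)) * ennreal (h y powr s)"
      using c by (simp add: ennreal_mult')
  qed auto
  also have "\<dots> = ennreal (2 * 2 powr s * 5 ^ DIM('a) * (c * 2 powr (s - 1))) * (\<integral>\<^sup>+y. ennreal (h y powr s) \<partial>lebesgue)"
    using c by (simp add: nn_integral_cmult mult.assoc ennreal_mult')
  also have "2 * 2 powr s * 5 ^ DIM('a) * (c * 2 powr (s - 1)) = K"
  proof -
    have "4 powr s = (2::real) powr s * 2 powr s"
      by (simp flip: powr_mult)
    then show ?thesis by (simp add: K_def powr_diff)
  qed
  finally show ?thesis by (simp add: Z_def)
  qed
  with K0 show ?thesis by blast
qed

section \<open>Log-Hoelder continuity and averages\<close>

text \<open>
  The multiplicative form of log-Hoelder continuity in which it is used: powers of a radius \<open>r\<close> do not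
  notice the oscillation of the exponent at scale \<open>r\<close>.
\<close>

definition log_Hoelder_bound :: "'a::real_normed_vector set \<Rightarrow> ('a \<Rightarrow> real) \<Rightarrow> real \<Rightarrow> bool" where
  "log_Hoelder_bound \<Omega> p K \<longleftrightarrow> 1 \<le> K \<and>
     (\<forall>x\<in>\<Omega>. \<forall>y\<in>\<Omega>. \<forall>r>0. norm (x - y) \<le> r \<longrightarrow> r powr (- \<bar>p x - p y\<bar>) \<le> K)"

text \<open>
  For \<open>r \<le> 1/2\<close> the power is \<open>exp (\<bar>p x - p y\<bar> ln (1/r))\<close>, to which the definition applies directly;
  for larger \<open>r\<close> boundedness of \<open>p\<close> suffices.
\<close>

lemma log_Hoelder_on_imp_bound:
  fixes p :: "real ^ 'n \<Rightarrow> real"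
  assumes "log_Hoelder_on \<Omega> p" and p: "\<And>x. x \<in> \<Omega> \<Longrightarrow> 0 \<le> p x \<and> p x \<le> P"
  obtains K where "log_Hoelder_bound \<Omega> p K"
proof -
  obtain C where C: "C > 0" and le: "\<And>x y. \<lbrakk>x \<in> \<Omega>; y \<in> \<Omega>; x \<noteq> y; norm (x - y) \<le> 1 / 2\<rbrakk> \<Longrightarrow>
        \<bar>p x - p y\<bar> \<le> C / ln (1 / norm (x - y))"
    using assms(1) unfolding log_Hoelder_on_def by blast
  define K where "K = max (exp C) (2 powr P)"
  have K1: "1 \<le> K" unfolding K_def using C by (simp add: le_max_iff_disj)
  have "r powr (- \<bar>p x - p y\<bar>) \<le> K"
    if xy: "x \<in> \<Omega>" "y \<in> \<Omega>" and r: "0 < r" "norm (x - y) \<le> r" for x y r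
  proof (cases "x = y")
    case True
    then show ?thesis using K1 r by simp
  next
    case ne: False
    show ?thesis
    proof (cases "r \<le> 1 / 2")
      case True
      have pos: "0 < norm (x - y)" using ne by simp
      have "0 < ln (1 / r)" using True r by simp
      moreover have "ln (1 / r) \<le> ln (1 / norm (x - y))"
        using r pos by (simp add: ln_div ln_mono)
      ultimately have "\<bar>p x - p y\<bar> * ln (1 / r) \<le> C / ln (1 / norm (x - y)) * ln (1 / norm (x - y))"
        using le[of x y] xy ne True r C by (intro mult_mono) auto
      also have "\<dots> = C" using \<open>0 < ln (1 / r)\<close> \<open>ln (1 / r) \<le> _\<close> by simp
      finally have "r powr (- \<bar>p x - p y\<bar>) \<le> exp C"
        using r by (simp add: powr_def ln_div)
      then show ?thesis by (simp add: K_def)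
    next
      case False
      have "r powr (- \<bar>p x - p y\<bar>) \<le> (1 / 2) powr (- \<bar>p x - p y\<bar>)"
        using False by (intro powr_mono2') auto
      also have "\<dots> = 2 powr \<bar>p x - p y\<bar>"
        by (simp add: powr_minus powr_divide)
      also have "\<dots> \<le> 2 powr P"
        using p[OF xy(1)] p[OF xy(2)] by (intro powr_mono) auto
      finally show ?thesis by (simp add: K_def)
    qed
  qed
  with K1 show ?thesis by (intro that) (auto simp: log_Hoelder_bound_def)
qed

text \<open>
  Used to pass from \<open>p\<close> to \<open>q\<close>: inversion is Lipschitz on compact subsets of the positive half-line.
\<close>

lemma log_Hoelder_bound_transfer:
  assumes K: "log_Hoelder_bound \<Omega> p K" and c: "0 \<le> c"
    and q: "\<And>x y. \<lbrakk>x \<in> \<Omega>; y \<in> \<Omega>\<rbrakk> \<Longrightarrow> \<bar>q x - q y\<bar> \<le> c * \<bar>p x - p y\<bar>"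
  shows "log_Hoelder_bound \<Omega> q (K powr c)"
proof -
  have K1: "1 \<le> K" using K by (simp add: log_Hoelder_bound_def)
  then have K2: "1 \<le> K powr c" using c by (rule ge_one_powr_ge_zero)
  have "r powr (- \<bar>q x - q y\<bar>) \<le> K powr c"
    if xy: "x \<in> \<Omega>" "y \<in> \<Omega>" and r: "0 < r" "norm (x - y) \<le> r" for x y r
  proof (cases "1 \<le> r")
    case True
    then have "r powr (- \<bar>q x - q y\<bar>) \<le> r powr 0" by (intro powr_mono) auto
    then show ?thesis using K2 r by simp
  next
    case False
    have "r powr (- \<bar>q x - q y\<bar>) \<le> r powr (- (c * \<bar>p x - p y\<bar>))"
      using False r q[OF xy] by (intro powr_mono') auto
    also have "\<dots> = (r powr (- \<bar>p x - p y\<bar>)) powr c"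
      by (simp add: powr_powr mult.commute)
    also have "\<dots> \<le> K powr c"
      using K xy r c by (intro powr_mono2) (auto simp: log_Hoelder_bound_def)
    finally show ?thesis .
  qed
  with K2 show ?thesis by (auto simp: log_Hoelder_bound_def)
qed

lemma log_Hoelder_bound_mono:
  "\<lbrakk>log_Hoelder_bound \<Omega> p K; K \<le> L\<rbrakk> \<Longrightarrow> log_Hoelder_bound \<Omega> p L"
  by (force simp: log_Hoelder_bound_def)

text \<open>
  Every quantity that lies between a power of \<open>r\<close> and a constant, up to constants, is as insensitive to
  the oscillation of the exponent as \<open>r\<close> itself.
\<close>

lemma powr_le_of_log_Hoelder_bound:
  fixes m :: real
  assumes K: "log_Hoelder_bound \<Omega> p K" and xy: "x \<in> \<Omega>" "y \<in> \<Omega>" "norm (x - y) \<le> r" "0 < r"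
    and B: "1 \<le> B" and z: "r powr m \<le> B * z" "z \<le> B" and m: "0 \<le> m"
    and \<tau>: "\<bar>\<tau>\<bar> \<le> \<bar>p x - p y\<bar>" "\<bar>p x - p y\<bar> \<le> P"
  shows "z powr \<tau> \<le> B powr P * K powr m"
proof -
  have K1: "1 \<le> K" using K by (simp add: log_Hoelder_bound_def)
  have K2: "1 \<le> K powr m" using K1 m by (rule ge_one_powr_ge_zero)
  have "0 < B * z" using z(1) xy(4) by (intro less_le_trans[OF _ z(1)]) simp
  then have z0: "0 < z" using B by (simp add: zero_less_mult_iff)
  show ?thesis
  proof (cases "0 \<le> \<tau>")
    case True
    have "z powr \<tau> \<le> B powr \<tau>" using True z z0 by (intro powr_mono2) auto
    also have "\<dots> \<le> B powr P" using True \<tau> B by (intro powr_mono) auto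
    also have "\<dots> \<le> B powr P * K powr m" using K2 by (simp add: mult_ge1_I[of _ "K powr m"] mult_le_cancel_left1)
    finally show ?thesis .
  next
    case False
    have "r powr m / B \<le> z" using z B by (simp add: field_simps)
    then have "z powr \<tau> \<le> (r powr m / B) powr \<tau>" using False xy B by (intro powr_mono2') auto
    also have "\<dots> = B powr (- \<tau>) * (r powr \<tau>) powr m"
      using xy B by (simp add: powr_divide powr_powr powr_minus field_simps)
    also have "\<dots> \<le> B powr P * K powr m"
    proof (intro mult_mono powr_mono2 powr_mono)
      show "r powr \<tau> \<le> K"
      proof (cases "1 \<le> r")
        case True
        then have "r powr \<tau> \<le> r powr 0" using False by (intro powr_mono) auto
        then show ?thesis using K1 xy by simp
      next
        case r: False
        have "r powr \<tau> \<le> r powr (- \<bar>p x - p y\<bar>)"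
          using r xy \<tau> by (intro powr_mono') auto
        also have "\<dots> \<le> K" using K xy by (auto simp: log_Hoelder_bound_def)
        finally show ?thesis .
      qed
    qed (use B \<tau> m in auto)
    finally show ?thesis .
  qed
qed

text \<open>
  A Jensen inequality for variable exponents.  With \<open>\<kappa> = (1 + a)\<^bsup>s/p(x)\<^esup>\<close>, a value \<open>g y > \<kappa>\<close> satisfies
  \<open>g y \<le> g y (g y / \<kappa>)\<^bsup>p(y)/s - 1\<^esup>\<close>, hence \<open>g y \<le> \<kappa> + \<kappa>\<^bsup>1 - p(y)/s\<^esup> g y\<^bsup>p(y)/s\<^esup>\<close> for every \<open>y\<close>.  The exponent
  \<open>p y\<close> of \<open>\<kappa>\<close> may be replaced by \<open>p x\<close>, because \<open>\<kappa>\<close> lies between \<open>1\<close> and a negative power of \<open>r\<close>.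
  Integration then gives a multiple of \<open>\<kappa> V + \<kappa>\<^bsup>1 - p(x)/s\<^esup> a V\<close>, and the second term is at most \<open>\<kappa> V\<close>
  by the choice of \<open>\<kappa>\<close>.
\<close>

lemma set_integral_le_modular_average:
  fixes \<Omega> :: "'a::euclidean_space set"
  assumes K: "log_Hoelder_bound \<Omega> p K" and x: "x \<in> \<Omega>"
    and S: "S \<subseteq> \<Omega>" "S \<in> sets lebesgue" and r: "0 < r" "\<And>y. y \<in> S \<Longrightarrow> norm (x - y) \<le> r"
    and s: "1 \<le> s" and p: "\<And>y. y \<in> \<Omega> \<Longrightarrow> s \<le> p y \<and> p y \<le> P"
    and g: "\<And>y. 0 \<le> g y"
    and meas: "(\<lambda>y. ennreal (g y powr (p y / s)) * indicator S y) \<in> borel_measurable lebesgue"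
    and V: "0 < V" "emeasure lebesgue S \<le> ennreal V"
    and a: "0 \<le> a" "(\<integral>\<^sup>+y\<in>S. ennreal (g y powr (p y / s)) \<partial>lebesgue) \<le> ennreal (a * V)"
    and B: "1 \<le> B" "(1 + a) * r powr m \<le> B" "0 \<le> m"
  shows "(\<integral>\<^sup>+y\<in>S. ennreal (g y) \<partial>lebesgue)
    \<le> ennreal ((1 + B powr P * K powr m) * V * (1 + a) powr (s / p x))"
proof -
  define \<kappa> where "\<kappa> = (1 + a) powr (s / p x)"
  define c where "c = B powr P * K powr m"
  have c0: "0 \<le> c" by (simp add: c_def)
  have px: "0 < p x" "s \<le> p x" using p[OF x] s by auto
  have "(1 + a) powr (s / p x) \<le> (1 + a) powr 1"
    using px s a by (intro powr_mono) auto
  then have \<kappa>: "1 \<le> \<kappa>" "\<kappa> \<le> 1 + a"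
    unfolding \<kappa>_def using px s a by (auto intro!: ge_one_powr_ge_zero)
  have \<kappa>_powr: "\<kappa> powr (p x / s) = 1 + a"
    unfolding \<kappa>_def using px s a by (simp add: powr_powr)
  have pointwise: "g y \<le> \<kappa> + c * \<kappa> powr (1 - p x / s) * g y powr (p y / s)" if y: "y \<in> S" for y
  proof (cases "g y \<le> \<kappa>")
    case True
    then show ?thesis using c0 by (intro add_increasing2) auto
  next
    case False
    have py: "s \<le> p y" "p y \<le> P" "y \<in> \<Omega>" using p y S by auto
    have "g y = g y powr (1 - p y / s) * g y powr (p y / s)"
      using False \<kappa> by (simp flip: powr_add)
    also have "\<dots> \<le> \<kappa> powr (1 - p y / s) * g y powr (p y / s)"
      using False \<kappa> py s by (intro mult_right_mono powr_mono2') auto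
    also have "\<kappa> powr (1 - p y / s) = \<kappa> powr (1 - p x / s) * (1 / \<kappa>) powr ((p y - p x) / s)"
      using \<kappa> s by (simp add: powr_divide powr_minus_divide[symmetric] diff_divide_distrib flip: powr_add)
    also have "(1 / \<kappa>) powr ((p y - p x) / s) \<le> c"
      unfolding c_def
    proof (rule powr_le_of_log_Hoelder_bound[OF K x py(3) r(2)[OF y] r(1) B(1)])
      have "r powr m * \<kappa> \<le> r powr m * (1 + a)" using \<kappa> by (intro mult_left_mono) auto
      also have "\<dots> \<le> B" using B by (simp add: mult.commute)
      finally show "r powr m \<le> B * (1 / \<kappa>)" using \<kappa> by (simp add: field_simps)
      have "1 / \<kappa> \<le> 1" using \<kappa> by simp
      then show "1 / \<kappa> \<le> B" using B by simp
      show "\<bar>(p y - p x) / s\<bar> \<le> \<bar>p x - p y\<bar>"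
        using s by (simp add: abs_minus_commute divide_le_eq mult_le_cancel_left1)
      show "\<bar>p x - p y\<bar> \<le> P" using p[OF x] py px s by auto
    qed (use B in auto)
    finally have "g y \<le> \<kappa> powr (1 - p x / s) * c * g y powr (p y / s)"
      by (simp add: mult_left_mono mult_right_mono)
    then show ?thesis using \<kappa> by (simp add: mult.commute)
  qed
  have "(\<integral>\<^sup>+y\<in>S. ennreal (g y) \<partial>lebesgue)
    \<le> (\<integral>\<^sup>+y. ennreal \<kappa> * indicator S y
        + ennreal (c * \<kappa> powr (1 - p x / s)) * (ennreal (g y powr (p y / s)) * indicator S y) \<partial>lebesgue)"
  proof (rule nn_integral_mono)
    fix y
    show "ennreal (g y) * indicator S y \<le> ennreal \<kappa> * indicator S y
        + ennreal (c * \<kappa> powr (1 - p x / s)) * (ennreal (g y powr (p y / s)) * indicator S y)"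
      using pointwise[of y] c0 \<kappa>
      by (auto split: split_indicator simp: ennreal_mult'[symmetric] ennreal_plus[symmetric] simp del: ennreal_plus intro!: ennreal_leI)
  qed
  also have "\<dots> = ennreal \<kappa> * emeasure lebesgue S
      + ennreal (c * \<kappa> powr (1 - p x / s)) * (\<integral>\<^sup>+y\<in>S. ennreal (g y powr (p y / s)) \<partial>lebesgue)"
    using S meas by (subst nn_integral_add) (simp_all add: nn_integral_cmult nn_integral_cmult_indicator del: emeasure_completion)
  also have "\<dots> \<le> ennreal \<kappa> * ennreal V + ennreal (c * \<kappa> powr (1 - p x / s)) * ennreal (a * V)"
    using V a by (intro add_mono mult_left_mono) auto
  also have "\<dots> = ennreal (\<kappa> * V + c * V * (\<kappa> powr (1 - p x / s) * a))"
    using \<kappa> V a c0 by (simp add: ennreal_mult'[symmetric] ennreal_plus[symmetric] mult_ac del: ennreal_plus)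
  also have "\<dots> \<le> ennreal ((1 + c) * V * \<kappa>)"
  proof (rule ennreal_leI)
    have "\<kappa> powr (1 - p x / s) * a \<le> \<kappa> powr (1 - p x / s) * (1 + a)" by (simp add: mult_left_mono)
    also have "\<dots> = \<kappa>" using \<kappa> by (simp add: \<kappa>_powr[symmetric] flip: powr_add)
    finally have "c * V * (\<kappa> powr (1 - p x / s) * a) \<le> c * V * \<kappa>"
      using c0 V by (intro mult_left_mono) auto
    then show "\<kappa> * V + c * V * (\<kappa> powr (1 - p x / s) * a) \<le> (1 + c) * V * \<kappa>"
      by (simp add: algebra_simps)
  qed
  finally show ?thesis by (simp add: \<kappa>_def c_def)
qed

section \<open>Small radii: the fractional Hedberg estimate\<close>

text \<open>
  A common constant \<open>K\<close> serves both exponents, and \<open>D\<close> bounds the diameter of \<open>\<Omega>\<close>.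
\<close>

locale variable_exponents =
  fixes \<Omega> :: "'a::euclidean_space set" and p q :: "'a \<Rightarrow> real" and \<alpha> s P Q K D :: real
  assumes sets_\<Omega>: "\<Omega> \<in> sets lebesgue"
    and p_measurable: "p \<in> borel_measurable (lebesgue_on \<Omega>)"
    and s_gt_1: "1 < s"
    and p_ge: "x \<in> \<Omega> \<Longrightarrow> s \<le> p x" and p_le: "x \<in> \<Omega> \<Longrightarrow> p x \<le> P"
    and \<alpha>_nonneg: "0 \<le> \<alpha>"
    and q_pos: "x \<in> \<Omega> \<Longrightarrow> 0 < q x" and q_le: "x \<in> \<Omega> \<Longrightarrow> q x \<le> Q"
    and q_eq: "x \<in> \<Omega> \<Longrightarrow> 1 / q x = 1 / p x - \<alpha> / real DIM('a)"
    and p_bound: "log_Hoelder_bound \<Omega> p K" and q_bound: "log_Hoelder_bound \<Omega> q K"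
    and D_ge_1: "1 \<le> D" and diameter: "\<lbrakk>x \<in> \<Omega>; y \<in> \<Omega>\<rbrakk> \<Longrightarrow> norm (x - y) \<le> D"
begin

definition "n = real DIM('a)"
definition "\<omega> = unit_ball_vol n"

definition unit_modular :: "('a \<Rightarrow> real) \<Rightarrow> bool" where
  "unit_modular g \<longleftrightarrow> g \<in> borel_measurable lebesgue \<and> (\<forall>y. 0 \<le> g y) \<and> (\<forall>y. y \<notin> \<Omega> \<longrightarrow> g y = 0) \<and>
     (\<integral>\<^sup>+y\<in>\<Omega>. ennreal (g y powr p y) \<partial>lebesgue) \<le> 1"

lemma n_ge_1: "1 \<le> n" by (simp add: n_def)

lemma \<omega>_pos: "0 < \<omega>" by (simp add: \<omega>_def n_def)

lemma p_gt_1: "x \<in> \<Omega> \<Longrightarrow> 1 < p x" using p_ge s_gt_1 by fastforce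

lemma p_le_q: "x \<in> \<Omega> \<Longrightarrow> p x \<le> q x"
proof -
  assume x: "x \<in> \<Omega>"
  have "1 / q x \<le> 1 / p x" using q_eq[OF x] \<alpha>_nonneg by simp
  then show ?thesis using q_pos[OF x] p_gt_1[OF x] by (simp add: field_simps)
qed

lemma emeasure_ball_powr: "0 < r \<Longrightarrow> emeasure lebesgue (ball (x::'a) r) = ennreal (\<omega> * r powr n)"
  by (simp add: emeasure_lebesgue_ball \<omega>_def n_def powr_realpow del: emeasure_completion)

lemma powr_p_measurable:
  assumes g: "g \<in> borel_measurable lebesgue" and S: "S \<subseteq> \<Omega>" "S \<in> sets lebesgue"
  shows "(\<lambda>y. g y powr (p y / t) * indicator S y) \<in> borel_measurable lebesgue"
proof -
  have "p \<in> borel_measurable (lebesgue_on S)"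
    using measurable_restrict_mono[OF p_measurable] S by auto
  moreover have "g \<in> borel_measurable (lebesgue_on S)"
    using g by (simp add: measurable_restrict_space1)
  ultimately have "(\<lambda>y. g y powr (p y / t)) \<in> borel_measurable (lebesgue_on S)"
    by measurable
  then show ?thesis
    using S by (subst (asm) borel_measurable_restrict_space_iff) (auto simp: mult.commute)
qed

lemma powr_p_measurable_ennreal:
  assumes g: "g \<in> borel_measurable lebesgue" and S: "S \<subseteq> \<Omega>" "S \<in> sets lebesgue"
  shows "(\<lambda>y. ennreal (g y powr (p y / t)) * indicator S y) \<in> borel_measurable lebesgue"
proof -
  have "(\<lambda>y. ennreal (g y powr (p y / t) * indicator S y)) \<in> borel_measurable lebesgue"
    using powr_p_measurable[OF assms] by measurable
  then show ?thesis
    by (rule measurable_cong[THEN iffD1, rotated]) (auto split: split_indicator)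
qed

text \<open>
  Jensen's inequality yields two bounds for the integral of \<open>g\<close>: \<open>r\<^sup>n (1 + m)\<^bsup>s/p(x)\<^esup>\<close> from the maximal
  function and \<open>r\<^bsup>n - n/p(x)\<^esup>\<close> from the unit modular, up to constants.  Their weighted geometric mean
  with weights \<open>1 - \<theta>\<close> and \<open>\<theta> = \<alpha> p(x) / n\<close> has the power \<open>n - \<alpha>\<close> of \<open>r\<close>, and
  \<open>(1 - \<theta>) / p(x) = 1 / q(x)\<close>.
\<close>

lemma local_fractional_average_le:
  assumes x: "x \<in> \<Omega>" and r: "0 < r" "r < D" and g: "unit_modular g"
    and m: "0 \<le> m" "HL_maximal D (\<lambda>y. ennreal (g y powr (p y / s) * indicator \<Omega> y)) x \<le> ennreal m"
    and B: "B = 2 * D powr n + 1 / \<omega>"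
  shows "(\<integral>\<^sup>+y\<in>ball x r. ennreal (g y) \<partial>lebesgue)
    \<le> ennreal ((1 + B powr P * K powr n) * B * \<omega> * r powr (n - \<alpha>) * (1 + m) powr (s / q x))"
proof -
  define S where "S = ball x r \<inter> \<Omega>"
  have S: "S \<subseteq> \<Omega>" "S \<in> sets lebesgue" unfolding S_def using sets_\<Omega> by auto
  define V where "V = \<omega> * r powr n"
  have V: "0 < V" unfolding V_def using \<omega>_pos r by simp
  have emS: "emeasure lebesgue S \<le> ennreal V"
    unfolding V_def emeasure_ball_powr[OF r(1), symmetric, of x]
    by (rule emeasure_mono) (auto simp: S_def)
  have g': "g \<in> borel_measurable lebesgue" "\<And>y. 0 \<le> g y" "\<And>y. y \<notin> \<Omega> \<Longrightarrow> g y = 0"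
    "(\<integral>\<^sup>+y\<in>\<Omega>. ennreal (g y powr p y) \<partial>lebesgue) \<le> 1"
    using g by (auto simp: unit_modular_def)
  define c where "c = 1 + B powr P * K powr n"
  have c1: "1 \<le> c" by (simp add: c_def)
  have rD: "r powr n \<le> D powr n" using r n_ge_1 by (intro powr_mono2) auto
  have D1: "1 \<le> D powr n" using D_ge_1 n_ge_1 by (intro ge_one_powr_ge_zero) auto
  have B1: "1 \<le> B" using B D1 \<omega>_pos by (simp add: add_increasing2)
  have rn: "0 < r powr n" using r by simp
  have I_eq: "(\<integral>\<^sup>+y\<in>ball x r. ennreal (g y) \<partial>lebesgue) = (\<integral>\<^sup>+y\<in>S. ennreal (g y) \<partial>lebesgue)"
    by (intro nn_integral_cong) (auto simp: S_def g'(3) split: split_indicator)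
  have rS: "norm (x - y) \<le> r" if "y \<in> S" for y
    using that by (simp add: S_def dist_norm)
  have mod_S: "(\<integral>\<^sup>+y\<in>S. ennreal (g y powr p y) \<partial>lebesgue) \<le> 1"
    by (rule order_trans[OF _ g'(4)]) (use S in \<open>auto intro!: nn_integral_mono split: split_indicator\<close>)
  have p1: "1 \<le> p y \<and> p y \<le> P" "s \<le> p y \<and> p y \<le> P" if "y \<in> \<Omega>" for y
    using p_gt_1[OF that] p_le[OF that] p_ge[OF that] by auto
  note avg = set_integral_le_modular_average[OF p_bound x S r(1) rS _ _ g'(2) powr_p_measurable_ennreal[OF g'(1) S] V emS _ _ B1]
  have first: "(\<integral>\<^sup>+y\<in>S. ennreal (g y) \<partial>lebesgue) \<le> ennreal (c * V * (1 + m) powr (s / p x))"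
  proof -
    \<comment> \<open>Both are upper bounds for the average of \<open>h\<close>.  The second one, which is polynomial in \<open>1 / r\<close>,
      is needed because \<open>m\<close> may be arbitrarily large compared with powers of \<open>1 / r\<close>.\<close>
    define a where "a = min m (1 + 1 / V)"
    have a0: "0 \<le> a" using m V by (simp add: a_def)
    have "(\<integral>\<^sup>+y\<in>S. ennreal (g y powr (p y / s)) \<partial>lebesgue) \<le> ennreal m * ennreal V"
    proof -
      have "(\<integral>\<^sup>+y\<in>S. ennreal (g y powr (p y / s)) \<partial>lebesgue)
        = (\<integral>\<^sup>+y\<in>ball x r. ennreal (g y powr (p y / s) * indicator \<Omega> y) \<partial>lebesgue)"
        by (intro nn_integral_cong) (auto simp: S_def split: split_indicator)
      also have "\<dots> \<le> ennreal m * emeasure lebesgue (ball x r)"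
        by (rule order_trans[OF average_le_HL_maximal[OF r] mult_right_mono[OF m(2)]]) simp
      finally show ?thesis unfolding V_def emeasure_ball_powr[OF r(1)] .
    qed
    moreover have "(\<integral>\<^sup>+y\<in>S. ennreal (g y powr (p y / s)) \<partial>lebesgue) \<le> ennreal ((1 + 1 / V) * V)"
    proof -
      have "(\<integral>\<^sup>+y\<in>S. ennreal (g y powr (p y / s)) \<partial>lebesgue)
         \<le> (\<integral>\<^sup>+y. indicator S y + ennreal (g y powr (p y / 1)) * indicator S y \<partial>lebesgue)"
      proof (rule nn_integral_mono)
        fix y
        have "g y powr (p y / s) \<le> 1 + g y powr p y" if "y \<in> \<Omega>"
        proof (cases "g y \<le> 1")
          case True
          then have "g y powr (p y / s) \<le> 1 powr (p y / s)"
            using p_gt_1[OF that] s_gt_1 g' by (intro powr_mono2) auto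
          then show ?thesis by (simp add: add_increasing2)
        next
          case False
          then have "g y powr (p y / s) \<le> g y powr (p y)"
            using p_gt_1[OF that] s_gt_1 by (intro powr_mono) (auto simp: divide_le_eq)
          then show ?thesis by simp
        qed
        then have "ennreal (g y powr (p y / s)) \<le> ennreal (1 + g y powr p y)" if "y \<in> S"
          using that S by (intro ennreal_leI) auto
        then show "ennreal (g y powr (p y / s)) * indicator S y \<le> indicator S y + ennreal (g y powr (p y / 1)) * indicator S y"
          by (auto split: split_indicator)
      qed
      also have "\<dots> = emeasure lebesgue S + (\<integral>\<^sup>+y\<in>S. ennreal (g y powr p y) \<partial>lebesgue)"
        using S powr_p_measurable_ennreal[OF g'(1) S, of 1] 
        by (subst nn_integral_add) (simp_all del: emeasure_completion)
      also have "\<dots> \<le> ennreal V + ennreal 1" using emS mod_S by (intro add_mono) auto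
      also have "\<dots> = ennreal ((1 + 1 / V) * V)" using V by (simp add: algebra_simps)
      finally show ?thesis .
    qed
    ultimately have "(\<integral>\<^sup>+y\<in>S. ennreal (g y powr (p y / s)) \<partial>lebesgue) \<le> ennreal (a * V)"
      using V m by (auto simp: a_def min_def ennreal_mult')
    moreover have "(1 + a) * r powr n \<le> B"
    proof -
      have "(1 + a) * r powr n \<le> (2 + 1 / V) * r powr n" using rn by (simp add: a_def mult_right_mono)
      also have "\<dots> = 2 * r powr n + 1 / \<omega>" using rn \<omega>_pos by (simp add: V_def field_simps)
      also have "\<dots> \<le> B" using rD B by simp
      finally show ?thesis .
    qed
    ultimately have "(\<integral>\<^sup>+y\<in>S. ennreal (g y) \<partial>lebesgue) \<le> ennreal (c * V * (1 + a) powr (s / p x))"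
      unfolding c_def by (intro avg) (use p1 s_gt_1 a0 n_ge_1 in auto)
    also have "\<dots> \<le> ennreal (c * V * (1 + m) powr (s / p x))"
      using c1 V a0 s_gt_1 p_gt_1[OF x] by (intro ennreal_leI mult_left_mono powr_mono2) (auto simp: a_def)
    finally show ?thesis .
  qed
  have second: "(\<integral>\<^sup>+y\<in>S. ennreal (g y) \<partial>lebesgue) \<le> ennreal (c * V * (B * r powr (- (n / p x))))"
  proof -
    have B': "(1 + 1 / V) * r powr n \<le> B"
    proof -
      have "(1 + 1 / V) * r powr n = r powr n + 1 / \<omega>" using rn \<omega>_pos by (simp add: V_def field_simps)
      also have "\<dots> \<le> B" using rD B D1 by linarith
      finally show ?thesis .
    qed
    have "(\<integral>\<^sup>+y\<in>S. ennreal (g y) \<partial>lebesgue) \<le> ennreal (c * V * (1 + 1 / V) powr (1 / p x))"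
      unfolding c_def by (rule avg) (use p1 V B' n_ge_1 mod_S in auto)
    also have "\<dots> \<le> ennreal (c * V * (B * r powr (- (n / p x))))"
    proof (intro ennreal_leI mult_left_mono)
      have "(1 + 1 / V) \<le> B * r powr (- n)"
        using B' rn by (simp add: powr_minus field_simps)
      then have "(1 + 1 / V) powr (1 / p x) \<le> (B * r powr (- n)) powr (1 / p x)"
        using V p_gt_1[OF x] by (intro powr_mono2) auto
      also have "\<dots> = B powr (1 / p x) * r powr (- (n / p x))"
        using B1 r by (simp add: powr_mult powr_powr)
      also have "\<dots> \<le> B powr 1 * r powr (- (n / p x))"
        using B1 p_gt_1[OF x] by (intro mult_right_mono powr_mono) auto
      finally show "(1 + 1 / V) powr (1 / p x) \<le> B * r powr (- (n / p x))" using B1 by simp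
    qed (use c1 V in auto)
    finally show ?thesis .
  qed
  define i where "i = enn2real (\<integral>\<^sup>+y\<in>S. ennreal (g y) \<partial>lebesgue)"
  have i: "(\<integral>\<^sup>+y\<in>S. ennreal (g y) \<partial>lebesgue) = ennreal i" "0 \<le> i"
    unfolding i_def using first by (auto simp: top_unique intro!: ennreal_enn2real[symmetric] less_top[THEN iffD1])
  define \<theta> where "\<theta> = \<alpha> * p x / n"
  have \<theta>0: "0 \<le> \<theta>" using \<alpha>_nonneg p_gt_1[OF x] n_ge_1 by (simp add: \<theta>_def)
  have \<theta>q: "(1 - \<theta>) / p x = 1 / q x"
    using q_eq[OF x] p_gt_1[OF x] n_ge_1 by (simp add: \<theta>_def n_def field_simps)
  then have \<theta>1: "\<theta> < 1" using q_pos[OF x] p_gt_1[OF x]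
    by (smt (verit) divide_nonpos_pos divide_pos_pos)
  have i1: "i \<le> c * V * (1 + m) powr (s / p x)"
    using first c1 V by (simp add: i ennreal_le_iff)
  have i2: "i \<le> c * V * (B * r powr (- (n / p x)))"
    using second c1 V B1 by (simp add: i ennreal_le_iff)
  have "i = i powr (1 - \<theta>) * i powr \<theta>" using i by (simp flip: powr_add)
  also have "\<dots> \<le> (c * V * (1 + m) powr (s / p x)) powr (1 - \<theta>) * (c * V * (B * r powr (- (n / p x)))) powr \<theta>"
    using i i1 i2 \<theta>0 \<theta>1 by (intro mult_mono powr_mono2) auto
  also have "\<dots> = (c * V) powr (1 - \<theta> + \<theta>) * (1 + m) powr (s / p x * (1 - \<theta>)) * (B powr \<theta> * r powr (- (n / p x) * \<theta>))"
    unfolding powr_add using c1 V m B1 by (simp add: powr_mult powr_powr)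
  also have "s / p x * (1 - \<theta>) = s / q x" using arg_cong[OF \<theta>q, of "\<lambda>t. s * t"] by simp
  also have "- (n / p x) * \<theta> = - \<alpha>" using p_gt_1[OF x] n_ge_1 by (simp add: \<theta>_def)
  also have "(c * V) powr (1 - \<theta> + \<theta>) * (1 + m) powr (s / q x) * (B powr \<theta> * r powr - \<alpha>)
     \<le> (c * V) * (1 + m) powr (s / q x) * (B powr 1 * r powr - \<alpha>)"
  proof -
    have "B powr \<theta> \<le> B powr 1" using B1 \<theta>1 by (intro powr_mono) auto
    then have "B powr \<theta> * r powr - \<alpha> \<le> B powr 1 * r powr - \<alpha>" by (rule mult_right_mono) simp
    then show ?thesis using c1 V by (simp add: mult_left_mono)
  qed
  also have "\<dots> = c * B * \<omega> * r powr (n - \<alpha>) * (1 + m) powr (s / q x)"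
    using B1 by (simp add: V_def powr_diff powr_minus divide_inverse)
  finally show ?thesis
    unfolding I_eq i c_def by (rule ennreal_leI)
qed

end

section \<open>Large radii: a discrete Hardy inequality\<close>

lemma powr_le_of_comparable:
  fixes t R \<tau> :: real
  assumes "R / 2 \<le> t" "t \<le> 2 * R" "0 < R"
  shows "t powr \<tau> \<le> 2 powr \<bar>\<tau>\<bar> * R powr \<tau>"
proof (cases "0 \<le> \<tau>")
  case True
  have "t powr \<tau> \<le> (2 * R) powr \<tau>" using assms True by (intro powr_mono2) auto
  also have "\<dots> = 2 powr \<bar>\<tau>\<bar> * R powr \<tau>" using assms True by (simp add: powr_mult)
  finally show ?thesis .
next
  case False
  have "t powr \<tau> \<le> (R / 2) powr \<tau>" using assms False by (intro powr_mono2') auto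
  also have "\<dots> = 2 powr \<bar>\<tau>\<bar> * R powr \<tau>"
  proof -
    have "2 powr \<bar>\<tau>\<bar> = 1 / (2::real) powr \<tau>"
      using False powr_minus_divide[of "2::real" \<tau>] by simp
    then show ?thesis using assms by (simp add: powr_divide)
  qed
  finally show ?thesis .
qed

lemma suminf_two_sided_geometric:
  fixes a :: real
  assumes a: "0 < a" "a < 1"
  shows "(\<Sum>j. ennreal (a ^ ((j - k) + (k - j)))) \<le> ennreal (2 / (1 - a))"
proof -
  define f where "f j = a ^ ((j - k) + (k - j))" for j :: nat
  have shift: "(\<lambda>j. f (j + k)) = (\<lambda>j. a ^ j)" by (auto simp: f_def)
  have sf: "summable f"
    using a summable_iff_shift[of f k] by (simp add: shift summable_geometric)
  have "suminf f = (\<Sum>j. a ^ j) + (\<Sum>j<k. f j)"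
    using suminf_split_initial_segment[OF sf, of k] by (simp add: shift)
  also have "(\<Sum>j<k. f j) = (\<Sum>j<k. a ^ (k - j))"
    by (intro sum.cong) (auto simp: f_def)
  also have "\<dots> \<le> (\<Sum>j<k. a ^ (k - Suc j))"
    using a by (intro sum_mono power_decreasing) auto
  also have "\<dots> = (\<Sum>j<k. a ^ j)" by (rule sum.nat_diff_reindex)
  also have "\<dots> \<le> (\<Sum>j. a ^ j)"
    using a by (intro sum_le_suminf summable_geometric) auto
  also have "(\<Sum>j. a ^ j) = 1 / (1 - a)" using a by (simp add: suminf_geometric)
  finally have "suminf f \<le> 2 / (1 - a)" by simp
  moreover have "(\<Sum>j. ennreal (f j)) = ennreal (suminf f)"
    using a by (intro suminf_ennreal2 sf) (auto simp: f_def)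
  ultimately show ?thesis by (simp add: f_def ennreal_leI)
qed

text \<open>
  For \<open>\<kappa> = u\<^bsup>1/t\<^esup>\<close> the right-hand side is \<open>2 \<kappa>\<close>.  Summing this linear bound against a summable kernel
  with a well-chosen \<open>\<kappa>\<close> replaces Jensen's inequality for the concave power.
\<close>

lemma powr_le_affine:
  fixes u \<kappa> t :: real
  assumes "0 \<le> u" "0 < \<kappa>" "1 \<le> t"
  shows "u powr (1 / t) \<le> \<kappa> + u * \<kappa> powr (1 - t)"
proof (cases "u powr (1 / t) \<le> \<kappa>")
  case True
  then show ?thesis using assms by (simp add: add_increasing2)
next
  case False
  then have u: "0 < u" using assms by (cases "u = 0") auto
  have "u powr (1 / t) = u * (u powr (1 / t)) powr (1 - t)"
  proof -
    have "1 / t = 1 + 1 / t * (1 - t)" using assms by (simp add: field_simps)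
    then have "u powr (1 / t) = u powr (1 + 1 / t * (1 - t))" by (rule arg_cong)
    also have "\<dots> = u powr 1 * (u powr (1 / t)) powr (1 - t)"
      by (simp only: powr_add powr_powr)
    finally show ?thesis using u by simp
  qed
  also have "\<dots> \<le> u * \<kappa> powr (1 - t)"
    using assms False by (intro mult_left_mono powr_mono2') auto
  finally show ?thesis using assms by simp
qed

text \<open>
  The two conditions on \<open>\<eta>\<close> make \<open>w\<^bsup>q(x0)\<^esup>\<close> and \<open>w\<^bsup>-p'(x0)\<^esup>\<close> locally integrable; note
  \<open>n / p'(x\<^sub>0) = n - n / p(x\<^sub>0)\<close>.
\<close>

locale power_weight_exponents = variable_exponents +
  fixes x0 :: 'a and \<eta> :: real
  assumes x0_in: "x0 \<in> \<Omega>"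
    and \<eta>_gt: "- (real DIM('a) / q x0) < \<eta>"
    and \<eta>_lt: "\<eta> < real DIM('a) - real DIM('a) / p x0"
begin

definition "w y = norm (y - x0) powr \<eta>"
definition "R k = D / 2 ^ k" for k :: nat
definition "shell k = {y\<in>\<Omega>. R (Suc k) < norm (y - x0) \<and> norm (y - x0) \<le> R k}"

text \<open>
  The smaller of the two gaps in the conditions on \<open>\<eta>\<close>; it is the rate of decay of the interaction
  between shells.
\<close>

definition "\<delta> = min (n - n / p x0 - \<eta>) (n / q x0 + \<eta>)"
definition "decay = 2 powr (- \<delta>)"

text \<open>
  On natural numbers \<open>(j - k) + (k - j)\<close> is \<open>\<bar>j - k\<bar>\<close>.
\<close>

definition "decay_kernel j k = decay ^ ((j - k) + (k - j))"
definition "shell_modular g k = enn2real (\<integral>\<^sup>+y\<in>shell k. ennreal (g y powr p y) \<partial>lebesgue)"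

text \<open>
  The volume term keeps \<open>mass g k\<close> above \<open>R k powr n\<close>, so that log-Hoelder continuity can be applied to
  its powers; as the volumes form a geometric series, the sum over \<open>k\<close> stays bounded.  The factor is
  \<open>1 + \<omega>\<close> instead of \<open>\<omega>\<close> in order to dominate both the volume and \<open>R k powr n\<close>.
\<close>

definition "mass g k = (1 + \<omega>) * R k powr n + shell_modular g k"

text \<open>
  A bound for the total mass, and thereby for every \<open>spread g j\<close>.
\<close>

definition "U = 2 * (1 + \<omega>) * D powr n + 1"

text \<open>
  The convolution of the masses with the decay kernel.
\<close>

definition "spread g j = enn2real (\<Sum>k. ennreal (decay_kernel j k * mass g k))"

lemma R_pos: "0 < R k" using D_ge_1 by (simp add: R_def)
lemma R_Suc: "R (Suc k) = R k / 2" by (simp add: R_def)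
lemma R_le: "R k \<le> D" using D_ge_1 by (simp add: R_def divide_le_eq mult_le_cancel_left1)

lemma R_powr: "R k powr t = D powr t * (2 powr (- t)) ^ k"
proof -
  have "R k powr t = D powr t / (2 ^ k) powr t"
    using D_ge_1 by (simp add: R_def powr_divide)
  also have "(2 ^ k) powr t = (2 powr t) ^ k"
    by (simp add: powr_realpow[symmetric] powr_powr mult.commute)
  finally show ?thesis by (simp only: powr_minus power_inverse divide_inverse)
qed

lemma R_powr_ratio:
  assumes "i \<le> j"
  shows "R j powr t * R i powr (- t) = (2 powr (- t)) ^ (j - i)"
proof -
  define c where "c = 2 powr (- t)"
  have c_inv: "c ^ i * (2 powr t) ^ i = 1"
    unfolding c_def power_mult_distrib[symmetric] powr_add[symmetric] by simp
  have D_inv: "D powr t * D powr (- t) = 1"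
    unfolding powr_add[symmetric] using D_ge_1 by simp
  have "R j powr t * R i powr (- t) = (D powr t * c ^ j) * (D powr (- t) * (2 powr t) ^ i)"
    unfolding R_powr[of j] R_powr[of i] c_def by (simp only: minus_minus)
  also have "c ^ j = c ^ (j - i) * c ^ i"
    unfolding power_add[symmetric] using assms by simp
  also have "(D powr t * (c ^ (j - i) * c ^ i)) * (D powr (- t) * (2 powr t) ^ i)
      = (D powr t * D powr (- t)) * (c ^ i * (2 powr t) ^ i) * c ^ (j - i)"
    by (simp only: mult_ac)
  finally show ?thesis by (simp only: c_inv D_inv mult_1_left c_def[symmetric])
qed

lemma Rn_le: "R k powr n \<le> D powr n"
  using R_le R_pos[of k] n_ge_1 by (intro powr_mono2) (auto intro: less_imp_le)

lemma \<delta>_pos: "0 < \<delta>" using \<eta>_gt \<eta>_lt by (simp add: \<delta>_def n_def)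

lemma decay: "0 < decay" "decay < 1"
  using \<delta>_pos powr_less_mono[of "- \<delta>" 0 2] by (auto simp: decay_def)

lemma Dn_ge_1: "1 \<le> D powr n" using D_ge_1 n_ge_1 by (intro ge_one_powr_ge_zero) auto

lemma U_ge: "1 \<le> U" "D powr n \<le> U"
proof -
  have "0 \<le> (1 + \<omega>) * D powr n" "0 \<le> \<omega> * D powr n" using \<omega>_pos by auto
  then show "1 \<le> U" "D powr n \<le> U" using Dn_ge_1 by (auto simp: U_def algebra_simps)
qed

lemma sets_shell [measurable]: "shell k \<in> sets lebesgue"
proof -
  have "shell k = \<Omega> \<inter> (cball x0 (R k) - cball x0 (R (Suc k)))"
    by (auto simp: shell_def dist_norm norm_minus_commute)
  then show ?thesis using sets_\<Omega> by auto
qed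

lemma shell_subset: "shell k \<subseteq> \<Omega>" by (auto simp: shell_def)

lemma disjoint_shell: "disjoint_family shell"
proof -
  have *: "shell i \<inter> shell j = {}" if "i < j" for i j
  proof -
    have "R j \<le> R (Suc i)"
      using that D_ge_1 unfolding R_def by (intro divide_left_mono power_increasing) auto
    then show ?thesis by (auto simp: shell_def)
  qed
  show ?thesis
    unfolding disjoint_family_on_def
    by (metis * Int_commute linorder_neqE_nat)
qed

lemma emeasure_shell: "emeasure lebesgue (shell k) \<le> ennreal (\<omega> * R k powr n)"
proof -
  have "emeasure lebesgue (shell k) \<le> emeasure lebesgue (cball x0 (R k))"
    by (rule emeasure_mono) (auto simp: shell_def dist_norm norm_minus_commute)
  also have "\<dots> = ennreal (\<omega> * R k powr n)"
    using R_pos[of k] by (simp add: emeasure_cball \<omega>_def n_def powr_realpow less_imp_le)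
  finally show ?thesis .
qed

text \<open>
  The shell index of a radius \<open>\<rho>\<close>.  Radii beyond \<open>R 0 = D\<close> are assigned to the outermost shell, whose
  outer ball already contains \<open>\<Omega>\<close>.
\<close>

lemma ex_shell_index:
  assumes "R (Suc j) < \<rho>"
  obtains i where "i \<le> j" "R (Suc i) < \<rho>" "\<rho> \<le> R i \<or> i = 0"
  using assms
proof (induction j arbitrary: thesis)
  case (Suc j)
  show ?case
  proof (cases "\<rho> \<le> R (Suc j)")
    case True
    then show ?thesis using Suc.prems by (intro Suc.prems(1)[of "Suc j"]) auto
  next
    case False
    then show ?thesis using Suc.IH[of thesis] Suc.prems(1) by (metis le_SucI not_le)
  qed
qed auto

lemma ex_shell:
  assumes "y \<in> \<Omega>" "y \<noteq> x0"
  obtains j where "y \<in> shell j"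
proof -
  have "0 < norm (y - x0) / D" using assms D_ge_1 by simp
  then obtain N where N: "(1 / 2) ^ N < norm (y - x0) / D"
    using real_arch_pow_inv[of "norm (y - x0) / D" "1 / 2"] by auto
  have "R (Suc N) \<le> R N" using R_pos[of N] by (simp add: R_Suc)
  moreover have "R N < norm (y - x0)" using N D_ge_1 by (simp add: R_def field_simps)
  ultimately have "R (Suc N) < norm (y - x0)" by linarith
  then obtain i where "R (Suc i) < norm (y - x0)" "norm (y - x0) \<le> R i \<or> i = 0"
    by (rule ex_shell_index)
  moreover have "norm (y - x0) \<le> R 0" using diameter[OF assms(1) x0_in] by (simp add: R_def)
  ultimately show ?thesis using assms by (intro that[of i]) (auto simp: shell_def)
qed

lemma shell_modular:
  assumes g: "unit_modular g"
  shows "(\<integral>\<^sup>+y\<in>shell k. ennreal (g y powr p y) \<partial>lebesgue) = ennreal (shell_modular g k)"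
    and "0 \<le> shell_modular g k" and "shell_modular g k \<le> 1"
    and "(\<Sum>k. ennreal (shell_modular g k)) \<le> 1"
proof -
  have g': "g \<in> borel_measurable lebesgue" "(\<integral>\<^sup>+y\<in>\<Omega>. ennreal (g y powr p y) \<partial>lebesgue) \<le> 1"
    using g by (auto simp: unit_modular_def)
  have le1: "(\<integral>\<^sup>+y\<in>shell k. ennreal (g y powr p y) \<partial>lebesgue) \<le> 1" for k
    by (rule order_trans[OF _ g'(2)]) (auto intro!: nn_integral_mono split: split_indicator dest: subsetD[OF shell_subset])
  show eq: "(\<integral>\<^sup>+y\<in>shell k. ennreal (g y powr p y) \<partial>lebesgue) = ennreal (shell_modular g k)" for k
    unfolding shell_modular_def by (rule ennreal_enn2real[symmetric]) (rule le_less_trans[OF le1], simp)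
  show "0 \<le> shell_modular g k" by (simp add: shell_modular_def)
  show "shell_modular g k \<le> 1" using le1[of k] by (simp add: eq)
  have "(\<Sum>k. ennreal (shell_modular g k)) = (\<integral>\<^sup>+y. (\<Sum>k. ennreal (g y powr p y) * indicator (shell k) y) \<partial>lebesgue)"
    unfolding eq[symmetric]
    using powr_p_measurable_ennreal[OF g'(1) shell_subset sets_shell, where t = 1]
    by (subst nn_integral_suminf) auto
  also have "\<dots> \<le> (\<integral>\<^sup>+y\<in>\<Omega>. ennreal (g y powr p y) \<partial>lebesgue)"
  proof (intro nn_integral_mono)
    fix y
    have "(\<Sum>k. ennreal (g y powr p y) * indicator (shell k) y) = ennreal (g y powr p y) * indicator (\<Union>k. shell k) y"
      using disjoint_shell by (simp add: suminf_indicator)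
    also have "\<dots> \<le> ennreal (g y powr p y) * indicator \<Omega> y"
      using shell_subset by (auto split: split_indicator)
    finally show "(\<Sum>k. ennreal (g y powr p y) * indicator (shell k) y) \<le> ennreal (g y powr p y) * indicator \<Omega> y" .
  qed
  finally show "(\<Sum>k. ennreal (shell_modular g k)) \<le> 1" using g'(2) by order
qed

lemma mass_bounds:
  assumes g: "unit_modular g"
  shows "R k powr n \<le> mass g k" "0 < mass g k" "(\<Sum>k. ennreal (mass g k)) \<le> ennreal U"
proof -
  have "0 \<le> \<omega> * R k powr n" using \<omega>_pos by simp
  then show le: "R k powr n \<le> mass g k" using shell_modular(2)[OF g, of k]
    unfolding mass_def distrib_right by simp
  show "0 < mass g k" using le R_pos[of k] by (intro less_le_trans[OF _ le]) simp
  have Vk: "(1 + \<omega>) * R k powr n \<le> (1 + \<omega>) * D powr n * (1 / 2) ^ k" for k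
  proof -
    have "2 powr (- n) \<le> (2::real) powr (- 1)" using n_ge_1 by (intro powr_mono) auto
    then have "(2 powr (- n)) ^ k \<le> ((1::real) / 2) ^ k"
      by (intro power_mono) (auto simp: powr_minus)
    then show ?thesis using \<omega>_pos by (simp add: R_powr mult_left_mono mult.assoc)
  qed
  have "(\<Sum>k. ennreal (mass g k)) = (\<Sum>k. ennreal ((1 + \<omega>) * R k powr n)) + (\<Sum>k. ennreal (shell_modular g k))"
    using \<omega>_pos shell_modular(2)[OF g] by (simp add: mass_def suminf_add)
  also have "\<dots> \<le> (\<Sum>k. ennreal ((1 + \<omega>) * D powr n * (1 / 2) ^ k)) + 1"
    by (intro add_mono suminf_le ennreal_leI Vk shell_modular(4)[OF g]) auto
  also have "(\<Sum>k. ennreal ((1 + \<omega>) * D powr n * (1 / 2) ^ k)) = ennreal (\<Sum>k. (1 + \<omega>) * D powr n * (1 / 2) ^ k)"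
    using \<omega>_pos by (intro suminf_ennreal2 summable_mult summable_geometric) auto
  also have "(\<Sum>k. (1 + \<omega>) * D powr n * (1 / 2) ^ k) = (1 + \<omega>) * D powr n * 2"
    by (subst suminf_mult) (auto simp: suminf_geometric summable_geometric)
  also have "ennreal ((1 + \<omega>) * D powr n * 2) + 1 = ennreal U"
    using \<omega>_pos by (simp add: U_def ac_simps)
  finally show "(\<Sum>k. ennreal (mass g k)) \<le> ennreal U" .
qed

lemma decay_kernel_bounds: "0 < decay_kernel j k" "decay_kernel j k \<le> 1" "decay_kernel j j = 1"
  using decay by (auto simp: decay_kernel_def power_le_one)

text \<open>
  The total spread is controlled by exchanging the two sums (Young's inequality for convolutions in
  \<open>l\<^sup>1\<close>).  The lower bound comes from the diagonal term of the kernel.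
\<close>

lemma spread_bounds:
  assumes g: "unit_modular g"
  shows "(\<Sum>k. ennreal (decay_kernel j k * mass g k)) = ennreal (spread g j)"
    and "R j powr n \<le> spread g j" "spread g j \<le> U" "0 < spread g j"
    and "(\<Sum>j. ennreal (spread g j)) \<le> ennreal (U * (2 / (1 - decay)))"
proof -
  have le: "(\<Sum>k. ennreal (decay_kernel j k * mass g k)) \<le> ennreal U" for j
  proof -
    have "(\<Sum>k. ennreal (decay_kernel j k * mass g k)) \<le> (\<Sum>k. ennreal (mass g k))"
      using decay_kernel_bounds[of j] mass_bounds(2)[OF g]
      by (intro suminf_le ennreal_leI) (auto simp: mult_le_cancel_right1)
    then show ?thesis using mass_bounds(3)[OF g] by order
  qed
  show eq: "(\<Sum>k. ennreal (decay_kernel j k * mass g k)) = ennreal (spread g j)" for j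
    unfolding spread_def by (rule ennreal_enn2real[symmetric]) (rule le_less_trans[OF le], simp)
  have v0: "0 \<le> spread g j" by (simp add: spread_def)
  have "ennreal (decay_kernel j j * mass g j) \<le> (\<Sum>k. ennreal (decay_kernel j k * mass g k))"
    using sum_le_suminf[of "\<lambda>k. ennreal (decay_kernel j k * mass g k)" "{j}"] by simp
  then have "mass g j \<le> spread g j" using v0 unfolding eq by (simp add: decay_kernel_bounds)
  then show "R j powr n \<le> spread g j" "0 < spread g j" using mass_bounds(1,2)[OF g, of j] by auto
  show "spread g j \<le> U" using le[of j] U_ge unfolding eq by simp
  have "(\<Sum>j. ennreal (spread g j)) = (\<Sum>j. \<integral>\<^sup>+k. ennreal (decay_kernel j k * mass g k) \<partial>count_space UNIV)"
    by (simp add: eq[symmetric] nn_integral_count_space_nat)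
  also have "\<dots> = (\<integral>\<^sup>+k. (\<Sum>j. ennreal (decay_kernel j k * mass g k)) \<partial>count_space UNIV)"
    by (rule nn_integral_suminf[symmetric]) simp
  also have "\<dots> = (\<Sum>k. \<Sum>j. ennreal (decay_kernel j k * mass g k))"
    by (simp add: nn_integral_count_space_nat)
  also have "\<dots> \<le> (\<Sum>k. ennreal (2 / (1 - decay)) * ennreal (mass g k))"
  proof (intro suminf_le)
    fix k
    have "(\<Sum>j. ennreal (decay_kernel j k * mass g k)) = (\<Sum>j. ennreal (decay_kernel j k)) * ennreal (mass g k)"
      using decay_kernel_bounds mass_bounds(2)[OF g, of k] by (simp add: ennreal_mult' ennreal_suminf_multc less_imp_le)
    also have "\<dots> \<le> ennreal (2 / (1 - decay)) * ennreal (mass g k)"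
      unfolding decay_kernel_def by (intro mult_right_mono suminf_two_sided_geometric decay) simp
    finally show "(\<Sum>j. ennreal (decay_kernel j k * mass g k)) \<le> ennreal (2 / (1 - decay)) * ennreal (mass g k)" .
  qed auto
  also have "\<dots> = ennreal (2 / (1 - decay)) * (\<Sum>k. ennreal (mass g k))" by simp
  also have "\<dots> \<le> ennreal (2 / (1 - decay)) * ennreal U"
    by (intro mult_left_mono mass_bounds(3)[OF g]) simp
  also have "\<dots> = ennreal (U * (2 / (1 - decay)))"
    using U_ge decay by (simp add: ennreal_mult'[symmetric] mult.commute)
  finally show "(\<Sum>j. ennreal (spread g j)) \<le> ennreal (U * (2 / (1 - decay)))" .
qed

text \<open>
  Jensen's inequality at the centre \<open>x\<^sub>0\<close> with \<open>s = 1\<close>, the average being that of \<open>g\<^sup>p\<close> over the shell.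
\<close>

lemma shell_integral_le:
  assumes g: "unit_modular g"
  shows "(\<integral>\<^sup>+y\<in>shell k. ennreal (g y) \<partial>lebesgue)
    \<le> ennreal ((1 + U powr P * K powr n) * (1 + \<omega>) * (R k powr (n - n / p x0) * mass g k powr (1 / p x0)))"
proof -
  define V where "V = (1 + \<omega>) * R k powr n"
  have V: "0 < V" using \<omega>_pos R_pos[of k] by (simp add: V_def)
  have emV: "emeasure lebesgue (shell k) \<le> ennreal V"
    by (rule order_trans[OF emeasure_shell]) (simp add: V_def ennreal_leI distrib_right)
  define c where "c = 1 + U powr P * K powr n"
  have c1: "1 \<le> c" by (simp add: c_def)
  define a where "a = shell_modular g k / V"
  have a: "0 \<le> a" using shell_modular(2)[OF g] V by (simp add: a_def)
  have g': "g \<in> borel_measurable lebesgue" "\<And>y. 0 \<le> g y" using g by (auto simp: unit_modular_def)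
  have a_eq: "1 + a = mass g k / V" using V by (simp add: a_def mass_def V_def field_simps)
  have p0: "1 < p x0" using p_gt_1[OF x0_in] .
  have "(\<integral>\<^sup>+y\<in>shell k. ennreal (g y) \<partial>lebesgue) \<le> ennreal (c * V * (1 + a) powr (1 / p x0))"
    unfolding c_def
  proof (rule set_integral_le_modular_average[OF p_bound x0_in shell_subset sets_shell R_pos _ _ _ g'(2)
        powr_p_measurable_ennreal[OF g'(1) shell_subset sets_shell] V emV a _ U_ge(1)])
    show "norm (x0 - y) \<le> R k" if "y \<in> shell k" for y using that by (simp add: shell_def norm_minus_commute)
    show "1 \<le> p y \<and> p y \<le> P" if "y \<in> \<Omega>" for y using p_gt_1[OF that] p_le[OF that] by simp
    show "(\<integral>\<^sup>+y\<in>shell k. ennreal (g y powr (p y / 1)) \<partial>lebesgue) \<le> ennreal (a * V)"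
      using V by (simp add: shell_modular(1)[OF g] a_def)
    have "(1 + a) * R k powr n = mass g k / (1 + \<omega>)"
      unfolding a_eq using R_pos[of k] by (simp add: V_def)
    also have "\<dots> = R k powr n + shell_modular g k / (1 + \<omega>)"
      using \<omega>_pos by (simp add: mass_def add_divide_distrib)
    also have "\<dots> \<le> D powr n + 1"
    proof (rule add_mono[OF Rn_le])
      have "shell_modular g k / (1 + \<omega>) \<le> shell_modular g k"
        using shell_modular(2)[OF g, of k] \<omega>_pos by (simp add: divide_le_eq mult_le_cancel_left1)
      then show "shell_modular g k / (1 + \<omega>) \<le> 1" using shell_modular(3)[OF g, of k] by linarith
    qed
    also have "\<dots> \<le> U"
    proof -
      have "0 \<le> \<omega> * D powr n" using \<omega>_pos by simp
      then show ?thesis using Dn_ge_1 by (simp add: U_def algebra_simps)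
    qed
    finally show "(1 + a) * R k powr n \<le> U" .
  qed (use n_ge_1 in auto)
  also have "c * V * (1 + a) powr (1 / p x0) = c * (V powr (1 - 1 / p x0) * mass g k powr (1 / p x0))"
    using V mass_bounds(2)[OF g, of k] unfolding a_eq by (simp add: powr_divide powr_diff)
  also have "\<dots> \<le> c * (((1 + \<omega>) * R k powr (n - n / p x0)) * mass g k powr (1 / p x0))"
  proof (intro mult_left_mono mult_right_mono)
    have "V powr (1 - 1 / p x0) = (1 + \<omega>) powr (1 - 1 / p x0) * R k powr (n - n / p x0)"
      using \<omega>_pos R_pos[of k] by (simp add: V_def powr_mult powr_powr right_diff_distrib)
    also have "\<dots> \<le> (1 + \<omega>) powr 1 * R k powr (n - n / p x0)"
      using \<omega>_pos p0 by (intro mult_right_mono powr_mono) auto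
    finally show "V powr (1 - 1 / p x0) \<le> (1 + \<omega>) * R k powr (n - n / p x0)" using \<omega>_pos by simp
  qed (use c1 in auto)
  finally show ?thesis by (simp add: c_def mult.assoc ennreal_leI)
qed

definition "C_shell = 2 powr \<bar>\<eta>\<bar> * ((1 + U powr P * K powr n) * (1 + \<omega>))"

lemma C_shell_pos: "0 < C_shell"
proof -
  have "0 < 1 + U powr P * K powr n" by (intro add_pos_nonneg) auto
  then show ?thesis using \<omega>_pos by (simp add: C_shell_def)
qed

lemma shell_integral_unweighted_le:
  assumes g: "unit_modular g" and f: "\<And>y. g y = w y * \<bar>f y\<bar>"
  shows "(\<integral>\<^sup>+y\<in>shell k. ennreal \<bar>f y\<bar> \<partial>lebesgue)
    \<le> ennreal (C_shell * (R k powr (n - n / p x0 - \<eta>) * mass g k powr (1 / p x0)))"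
proof -
  have [measurable]: "g \<in> borel_measurable lebesgue" using g by (simp add: unit_modular_def)
  have "(\<integral>\<^sup>+y\<in>shell k. ennreal \<bar>f y\<bar> \<partial>lebesgue)
     \<le> (\<integral>\<^sup>+y. ennreal (2 powr \<bar>\<eta>\<bar> * R k powr (- \<eta>)) * (ennreal (g y) * indicator (shell k) y) \<partial>lebesgue)"
  proof (rule nn_integral_mono)
    fix y
    have "\<bar>f y\<bar> \<le> 2 powr \<bar>\<eta>\<bar> * R k powr (- \<eta>) * g y" if "y \<in> shell k"
    proof -
      have y: "R k / 2 < norm (y - x0)" "norm (y - x0) \<le> R k" using that by (auto simp: shell_def R_Suc)
      have "norm (y - x0) \<noteq> 0" using y(1) R_pos[of k] by linarith
      then have "\<bar>f y\<bar> = norm (y - x0) powr (- \<eta>) * g y"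
        by (simp add: f w_def powr_minus)
      also have "\<dots> \<le> 2 powr \<bar>\<eta>\<bar> * R k powr (- \<eta>) * g y"
        using powr_le_of_comparable[of "R k" "norm (y - x0)" "- \<eta>"] y R_pos[of k] g
        by (intro mult_right_mono) (auto simp: unit_modular_def)
      finally show ?thesis .
    qed
    then show "ennreal \<bar>f y\<bar> * indicator (shell k) y
       \<le> ennreal (2 powr \<bar>\<eta>\<bar> * R k powr (- \<eta>)) * (ennreal (g y) * indicator (shell k) y)"
      by (auto split: split_indicator simp: ennreal_mult'[symmetric] intro!: ennreal_leI)
  qed
  also have "\<dots> = ennreal (2 powr \<bar>\<eta>\<bar> * R k powr (- \<eta>)) * (\<integral>\<^sup>+y\<in>shell k. ennreal (g y) \<partial>lebesgue)"
    by (rule nn_integral_cmult) simp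
  also have "\<dots> \<le> ennreal (2 powr \<bar>\<eta>\<bar> * R k powr (- \<eta>)) *
      ennreal ((1 + U powr P * K powr n) * (1 + \<omega>) * (R k powr (n - n / p x0) * mass g k powr (1 / p x0)))"
    by (intro mult_left_mono shell_integral_le g) simp
  also have "\<dots> = ennreal (C_shell * (R k powr (n - n / p x0 - \<eta>) * mass g k powr (1 / p x0)))"
  proof -
    have "R k powr (n - n / p x0 - \<eta>) = R k powr (- \<eta>) * R k powr (n - n / p x0)"
      using R_pos[of k] by (simp flip: powr_add)
    then show ?thesis by (subst ennreal_mult'[symmetric]) (simp_all add: C_shell_def mult_ac)
  qed
  finally show ?thesis .
qed

text \<open>
  The centre \<open>x\<^sub>0\<close> belongs to no shell and is discarded as a null set; the value of \<open>f\<close> there is not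
  determined by \<open>w f\<close>.
\<close>

lemma integral_le_shell_sum:
  assumes f: "\<And>y. y \<notin> \<Omega> \<Longrightarrow> y \<noteq> x0 \<Longrightarrow> f y = 0" "f \<in> borel_measurable lebesgue" and \<rho>: "\<rho> \<le> R i \<or> i = 0"
  shows "(\<integral>\<^sup>+y\<in>ball x0 \<rho>. ennreal \<bar>f y\<bar> \<partial>lebesgue)
    \<le> (\<Sum>k. of_bool (i \<le> k) * (\<integral>\<^sup>+y\<in>shell k. ennreal \<bar>f y\<bar> \<partial>lebesgue))"
proof -
  note [measurable] = f(2)
  have "(\<integral>\<^sup>+y\<in>ball x0 \<rho>. ennreal \<bar>f y\<bar> \<partial>lebesgue)
     \<le> (\<integral>\<^sup>+y. (\<Sum>k. of_bool (i \<le> k) * (ennreal \<bar>f y\<bar> * indicator (shell k) y)) \<partial>lebesgue)"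
  proof (rule nn_integral_mono_AE)
    have "AE y in lebesgue. y \<noteq> x0"
      by (rule AE_I[of _ _ "{x0}"]) auto
    then show "AE y in lebesgue. ennreal \<bar>f y\<bar> * indicator (ball x0 \<rho>) y
        \<le> (\<Sum>k. of_bool (i \<le> k) * (ennreal \<bar>f y\<bar> * indicator (shell k) y))"
    proof (rule AE_mp, intro AE_I2 impI)
      fix y assume ne: "y \<noteq> x0"
      show "ennreal \<bar>f y\<bar> * indicator (ball x0 \<rho>) y
        \<le> (\<Sum>k. of_bool (i \<le> k) * (ennreal \<bar>f y\<bar> * indicator (shell k) y))"
      proof (cases "y \<in> \<Omega> \<and> y \<in> ball x0 \<rho>")
        case True
        then obtain j where j: "y \<in> shell j" using ne ex_shell by blast
        have "i \<le> j"
        proof (rule ccontr)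
          assume "\<not> i \<le> j"
          then have "R i \<le> R (Suc j)"
            using D_ge_1 unfolding R_def by (intro divide_left_mono power_increasing) auto
          moreover have "norm (y - x0) < \<rho>" using True by (simp add: dist_norm norm_minus_commute)
          ultimately show False using \<rho> j \<open>\<not> i \<le> j\<close> by (auto simp: shell_def)
        qed
        define F where "F k = of_bool (i \<le> k) * (ennreal \<bar>f y\<bar> * indicator (shell k) y)" for k
        have "ennreal \<bar>f y\<bar> = F j"
          using j \<open>i \<le> j\<close> by (simp add: F_def)
        also have "\<dots> \<le> (\<Sum>k. F k)"
          using sum_le_suminf[of F "{j}"] by simp
        finally show ?thesis using True by (simp add: F_def)
      next
        case False
        then show ?thesis using f ne by (auto split: split_indicator)
      qed
    qed
  qed
  also have "\<dots> = (\<Sum>k. of_bool (i \<le> k) * (\<integral>\<^sup>+y\<in>shell k. ennreal \<bar>f y\<bar> \<partial>lebesgue))"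
    by (simp add: nn_integral_suminf nn_integral_cmult)
  finally show ?thesis .
qed

definition "C_global = 2 powr (n + 2 * \<bar>\<eta>\<bar>) * C_shell * (2 / (1 - decay) + 1)"

text \<open>
  For \<open>x\<close> in the \<open>j\<close>-th shell and \<open>\<rho>\<close> of the order of \<open>R i\<close>, \<open>i \<le> j\<close>, the \<open>k\<close>-th shell with \<open>i \<le> k\<close>
  contributes the factor \<open>(R j / R i)\<^bsup>\<delta>2\<^esup> (R k / R i)\<^bsup>\<delta>1\<^esup>\<close> with positive gaps \<open>\<delta>1\<close>, \<open>\<delta>2\<close>.  By the triangle
  inequality \<open>(j - i) + (k - i) \<ge> \<bar>j - k\<bar>\<close> this is at most \<open>decay_kernel j k\<close>, which no longer involves
  \<open>i\<close>; so the supremum over \<open>\<rho>\<close> costs nothing.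
\<close>

lemma global_fractional_average_le:
  assumes g: "unit_modular g" and f: "\<And>y. g y = w y * \<bar>f y\<bar>" "f \<in> borel_measurable lebesgue"
    and x: "x \<in> shell j" and \<rho>: "norm (x - x0) \<le> \<rho>"
  shows "ennreal (w x * \<rho> powr (\<alpha> - n)) * (\<integral>\<^sup>+y\<in>ball x0 \<rho>. ennreal \<bar>f y\<bar> \<partial>lebesgue)
    \<le> ennreal (C_global * (R j powr (- (n / q x0)) * spread g j powr (1 / p x0)))"
proof -
  have f0: "f y = 0" if "y \<notin> \<Omega>" "y \<noteq> x0" for y
  proof -
    have "g y = 0" using g that by (simp add: unit_modular_def)
    then show ?thesis using that by (simp add: f w_def)
  qed
  have xs: "R j / 2 < norm (x - x0)" "norm (x - x0) \<le> R j" using x by (auto simp: shell_def R_Suc)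
  have "R (Suc j) < \<rho>" using xs \<rho> by (simp add: R_Suc)
  then obtain i where i: "i \<le> j" "R (Suc i) < \<rho>" "\<rho> \<le> R i \<or> i = 0"
    by (rule ex_shell_index)
  define \<delta>1 where "\<delta>1 = n - n / p x0 - \<eta>"
  define \<delta>2 where "\<delta>2 = n / q x0 + \<eta>"
  have \<alpha>_eq: "\<alpha> - n = - \<delta>1 - \<delta>2"
    using q_eq[OF x0_in] n_ge_1 q_pos[OF x0_in] p_gt_1[OF x0_in] by (simp add: \<delta>1_def \<delta>2_def n_def field_simps)
  have \<delta>s: "\<delta> \<le> \<delta>1" "\<delta> \<le> \<delta>2" by (auto simp: \<delta>_def \<delta>1_def \<delta>2_def)
  \<comment> \<open>With this threshold in \<open>powr_le_affine\<close> both resulting sums are multiples of \<open>\<kappa>\<close>.\<close>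
  define \<kappa> where "\<kappa> = spread g j powr (1 / p x0)"
  have \<kappa>: "0 < \<kappa>" using spread_bounds(4)[OF g, of j] by (simp add: \<kappa>_def)
  have p0: "1 < p x0" using p_gt_1[OF x0_in] .
  define b where "b = 2 / (1 - decay)"
  have b0: "0 \<le> b" using decay by (simp add: b_def)
  have w_le: "w x \<le> 2 powr \<bar>\<eta>\<bar> * R j powr \<eta>"
    unfolding w_def using xs R_pos[of j] by (intro powr_le_of_comparable) auto
  have \<rho>_le: "\<rho> powr (\<alpha> - n) \<le> 2 powr n * R i powr (\<alpha> - n)"
  proof -
    have neg: "\<alpha> - n \<le> 0" using \<alpha>_eq \<delta>s \<delta>_pos by simp
    have "\<rho> powr (\<alpha> - n) \<le> (R i / 2) powr (\<alpha> - n)"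
      using i(2) R_pos[of i] neg by (intro powr_mono2') (auto simp: R_Suc)
    also have "\<dots> = 2 powr (n - \<alpha>) * R i powr (\<alpha> - n)"
      using R_pos[of i] powr_minus_divide[of 2 "n - \<alpha>"] by (simp add: powr_divide less_imp_le)
    also have "\<dots> \<le> 2 powr n * R i powr (\<alpha> - n)"
      using \<alpha>_nonneg by (intro mult_right_mono powr_mono) auto
    finally show ?thesis .
  qed
  define c where "c = 2 powr (n + 2 * \<bar>\<eta>\<bar>) * C_shell"
  have c0: "0 \<le> c" using C_shell_pos by (simp add: c_def less_imp_le)
  have pref: "w x * \<rho> powr (\<alpha> - n) * C_shell \<le> c * (R j powr \<eta> * R i powr (\<alpha> - n))"
  proof -
    have "w x * \<rho> powr (\<alpha> - n) * C_shell \<le> (2 powr \<bar>\<eta>\<bar> * R j powr \<eta>) * (2 powr n * R i powr (\<alpha> - n)) * C_shell"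
      using w_le \<rho>_le C_shell_pos by (intro mult_mono mult_nonneg_nonneg) (auto simp: w_def)
    also have "\<dots> = 2 powr (n + \<bar>\<eta>\<bar>) * C_shell * (R j powr \<eta> * R i powr (\<alpha> - n))"
      by (simp add: powr_add)
    also have "\<dots> \<le> c * (R j powr \<eta> * R i powr (\<alpha> - n))"
      unfolding c_def using C_shell_pos by (intro mult_right_mono powr_mono) auto
    finally show ?thesis .
  qed
  have term_le: "w x * \<rho> powr (\<alpha> - n) * (C_shell * (R k powr \<delta>1 * mass g k powr (1 / p x0)))
     \<le> c * R j powr (- (n / q x0)) * (decay_kernel j k * \<kappa> + \<kappa> powr (1 - p x0) * (decay_kernel j k * mass g k))"
    if k: "i \<le> k" for k
  proof -
    have decay_powr: "2 powr (- t) \<le> decay" if "\<delta> \<le> t" for t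
      unfolding decay_def using that by (intro powr_mono) auto
    have "R j powr \<eta> * R i powr (\<alpha> - n) * R k powr \<delta>1
        = R j powr (- (n / q x0)) * (R j powr \<delta>2 * R i powr (- \<delta>2)) * (R k powr \<delta>1 * R i powr (- \<delta>1))"
    proof -
      have "R j powr \<eta> = R j powr (- (n / q x0)) * R j powr \<delta>2"
        unfolding \<delta>2_def by (simp flip: powr_add)
      moreover have "R i powr (\<alpha> - n) = R i powr (- \<delta>2) * R i powr (- \<delta>1)"
        unfolding \<alpha>_eq by (simp add: powr_add[symmetric] algebra_simps)
      ultimately show ?thesis by (simp only: mult_ac)
    qed
    also have "R j powr \<delta>2 * R i powr (- \<delta>2) = (2 powr (- \<delta>2)) ^ (j - i)"
      using i(1) by (rule R_powr_ratio)
    also have "R k powr \<delta>1 * R i powr (- \<delta>1) = (2 powr (- \<delta>1)) ^ (k - i)"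
      using k by (rule R_powr_ratio)
    also have "R j powr (- (n / q x0)) * (2 powr (- \<delta>2)) ^ (j - i) * (2 powr (- \<delta>1)) ^ (k - i)
       \<le> R j powr (- (n / q x0)) * decay ^ (j - i) * decay ^ (k - i)"
      using decay \<delta>s by (intro mult_mono power_mono decay_powr) auto
    also have "\<dots> \<le> R j powr (- (n / q x0)) * decay_kernel j k"
      unfolding decay_kernel_def mult.assoc power_add[symmetric]
      using decay k i(1) by (intro mult_left_mono power_decreasing) auto
    finally have main: "R j powr \<eta> * R i powr (\<alpha> - n) * R k powr \<delta>1 \<le> R j powr (- (n / q x0)) * decay_kernel j k" .
    have "w x * \<rho> powr (\<alpha> - n) * (C_shell * (R k powr \<delta>1 * mass g k powr (1 / p x0)))
      = (w x * \<rho> powr (\<alpha> - n) * C_shell) * (R k powr \<delta>1 * mass g k powr (1 / p x0))" by simp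
    also have "\<dots> \<le> (c * (R j powr \<eta> * R i powr (\<alpha> - n))) * (R k powr \<delta>1 * mass g k powr (1 / p x0))"
      by (intro mult_right_mono pref) auto
    also have "\<dots> = c * (R j powr \<eta> * R i powr (\<alpha> - n) * R k powr \<delta>1) * mass g k powr (1 / p x0)" by simp
    also have "\<dots> \<le> c * (R j powr (- (n / q x0)) * decay_kernel j k) * mass g k powr (1 / p x0)"
      by (intro mult_right_mono mult_left_mono main c0) auto
    also have "\<dots> \<le> c * (R j powr (- (n / q x0)) * decay_kernel j k) * (\<kappa> + mass g k * \<kappa> powr (1 - p x0))"
      using c0 decay_kernel_bounds(1)[of j k] mass_bounds(2)[OF g, of k] \<kappa> p0
      by (intro mult_left_mono powr_le_affine) auto
    finally show ?thesis by (simp add: algebra_simps)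
  qed
  have "ennreal (w x * \<rho> powr (\<alpha> - n)) * (\<integral>\<^sup>+y\<in>ball x0 \<rho>. ennreal \<bar>f y\<bar> \<partial>lebesgue)
    \<le> ennreal (w x * \<rho> powr (\<alpha> - n)) * (\<Sum>k. of_bool (i \<le> k) * (\<integral>\<^sup>+y\<in>shell k. ennreal \<bar>f y\<bar> \<partial>lebesgue))"
    by (intro mult_left_mono integral_le_shell_sum f0 f i) auto
  also have "\<dots> = (\<Sum>k. ennreal (w x * \<rho> powr (\<alpha> - n)) * (of_bool (i \<le> k) * (\<integral>\<^sup>+y\<in>shell k. ennreal \<bar>f y\<bar> \<partial>lebesgue)))"
    by simp
  also have "\<dots> \<le> (\<Sum>k. ennreal (c * R j powr (- (n / q x0))) *
       (ennreal \<kappa> * ennreal (decay_kernel j k) + ennreal (\<kappa> powr (1 - p x0)) * ennreal (decay_kernel j k * mass g k)))"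
  proof (intro suminf_le)
    fix k
    show "ennreal (w x * \<rho> powr (\<alpha> - n)) * (of_bool (i \<le> k) * (\<integral>\<^sup>+y\<in>shell k. ennreal \<bar>f y\<bar> \<partial>lebesgue))
      \<le> ennreal (c * R j powr (- (n / q x0))) *
       (ennreal \<kappa> * ennreal (decay_kernel j k) + ennreal (\<kappa> powr (1 - p x0)) * ennreal (decay_kernel j k * mass g k))"
    proof (cases "i \<le> k")
      case True
      have "ennreal (w x * \<rho> powr (\<alpha> - n)) * (\<integral>\<^sup>+y\<in>shell k. ennreal \<bar>f y\<bar> \<partial>lebesgue)
        \<le> ennreal (w x * \<rho> powr (\<alpha> - n)) * ennreal (C_shell * (R k powr \<delta>1 * mass g k powr (1 / p x0)))"
        unfolding \<delta>1_def by (intro mult_left_mono shell_integral_unweighted_le g f) auto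
      also have "\<dots> = ennreal (w x * \<rho> powr (\<alpha> - n) * (C_shell * (R k powr \<delta>1 * mass g k powr (1 / p x0))))"
        by (rule ennreal_mult'[symmetric]) (simp add: w_def)
      also have "\<dots> \<le> ennreal (c * R j powr (- (n / q x0)) * (decay_kernel j k * \<kappa> + \<kappa> powr (1 - p x0) * (decay_kernel j k * mass g k)))"
        by (intro ennreal_leI term_le True)
      also have "\<dots> = ennreal (c * R j powr (- (n / q x0))) *
        (ennreal \<kappa> * ennreal (decay_kernel j k) + ennreal (\<kappa> powr (1 - p x0)) * ennreal (decay_kernel j k * mass g k))"
        using c0 \<kappa> decay_kernel_bounds(1)[of j k] mass_bounds(2)[OF g, of k]
        by (simp add: ennreal_mult' less_imp_le mult.commute)
      finally show ?thesis using True by simp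
    qed simp
  qed auto
  also have "\<dots> = ennreal (c * R j powr (- (n / q x0))) *
       (ennreal \<kappa> * (\<Sum>k. ennreal (decay_kernel j k)) + ennreal (\<kappa> powr (1 - p x0)) * (\<Sum>k. ennreal (decay_kernel j k * mass g k)))"
    by (simp add: suminf_add[symmetric])
  also have "\<dots> \<le> ennreal (c * R j powr (- (n / q x0))) *
       (ennreal \<kappa> * ennreal (b) + ennreal (\<kappa> powr (1 - p x0)) * ennreal (spread g j))"
  proof (intro mult_left_mono add_mono)
    show "(\<Sum>k. ennreal (decay_kernel j k)) \<le> ennreal (b)"
      using suminf_two_sided_geometric[OF decay, of j] by (simp add: decay_kernel_def b_def add.commute)
    show "(\<Sum>k. ennreal (decay_kernel j k * mass g k)) \<le> ennreal (spread g j)" by (simp add: spread_bounds(1)[OF g])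
  qed auto
  also have "\<dots> = ennreal (c * R j powr (- (n / q x0)) * (\<kappa> * (b) + \<kappa> powr (1 - p x0) * spread g j))"
    using c0 \<kappa> b0 spread_bounds(4)[OF g, of j] by (simp add: ennreal_mult' less_imp_le)
  also have "\<kappa> powr (1 - p x0) * spread g j = \<kappa>"
  proof -
    have "spread g j = \<kappa> powr p x0" using p0 spread_bounds(4)[OF g, of j] by (simp add: \<kappa>_def powr_powr)
    then show ?thesis using \<kappa> by (simp flip: powr_add)
  qed
  also have "c * R j powr (- (n / q x0)) * (\<kappa> * (b) + \<kappa>)
     = C_global * (R j powr (- (n / q x0)) * spread g j powr (1 / p x0))"
    by (simp add: C_global_def c_def b_def \<kappa>_def algebra_simps)
  finally show ?thesis .
qed

definition "C_power = U powr Q * K powr n * (U powr Q * K powr n * U powr Q)"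

text \<open>
  Replacing \<open>q x\<close> by \<open>q x\<^sub>0\<close> costs a constant, since \<open>R j powr n\<close> and \<open>spread g j\<close> both lie between
  \<open>R j powr n\<close> and \<open>U\<close>.  Afterwards \<open>spread g j\<close> has the exponent \<open>q x\<^sub>0 / p x\<^sub>0 \<ge> 1\<close>, which is lowered to \<open>1\<close>
  by boundedness; this is where the gain from \<open>p\<close> to \<open>q\<close> is given away.
\<close>

lemma shell_power_le:
  assumes g: "unit_modular g" and x: "x \<in> shell j"
  shows "(R j powr (- (n / q x0)) * spread g j powr (1 / p x0)) powr q x \<le> C_power * (R j powr (- n) * spread g j)"
proof -
  have xO: "x \<in> \<Omega>" and xr: "norm (x - x0) \<le> R j" using x by (auto simp: shell_def)
  note q = q_pos[OF xO] q_le[OF xO] q_pos[OF x0_in] q_le[OF x0_in]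
  have p0: "1 < p x0" "p x0 \<le> q x0" using p_gt_1 p_le_q x0_in by auto
  have v: "0 < spread g j" "R j powr n \<le> spread g j" "spread g j \<le> U" using spread_bounds[OF g] by auto
  have R: "0 < R j" by (rule R_pos)
  have diff: "\<bar>q x - q x0\<bar> \<le> Q" using q by auto
  have U1: "1 \<le> U" by (rule U_ge)
  note cmp = powr_le_of_log_Hoelder_bound[OF q_bound xO x0_in xr R U1 _ _ _ _ diff, of n]
  have 1: "(R j powr n) powr ((q x0 - q x) / q x0) \<le> U powr Q * K powr n"
  proof (rule cmp)
    show "R j powr n \<le> U * (R j powr n)" using U1 by (simp add: mult_le_cancel_right1)
    show "R j powr n \<le> U" using Rn_le U_ge(2) by (rule order_trans)
    show "\<bar>(q x0 - q x) / q x0\<bar> \<le> \<bar>q x - q x0\<bar>"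
      using p0 by (simp add: abs_minus_commute divide_le_eq mult_le_cancel_left1)
  qed (use n_ge_1 in auto)
  have 2: "spread g j powr ((q x - q x0) / p x0) \<le> U powr Q * K powr n"
  proof (rule cmp)
    have "1 * spread g j \<le> U * spread g j" using U1 v by (intro mult_right_mono) auto
    then show "R j powr n \<le> U * spread g j" using v(2) by linarith
    show "spread g j \<le> U" by fact
    show "\<bar>(q x - q x0) / p x0\<bar> \<le> \<bar>q x - q x0\<bar>"
      using p0 by (simp add: divide_le_eq mult_le_cancel_left1)
  qed (use n_ge_1 in auto)
  have 3: "spread g j powr (q x0 / p x0 - 1) \<le> U powr Q"
  proof -
    have "spread g j powr (q x0 / p x0 - 1) \<le> U powr (q x0 / p x0 - 1)"
      using v p0 by (intro powr_mono2) auto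
    also have "\<dots> \<le> U powr Q"
    proof (rule powr_mono[OF _ U1])
      have "q x0 / p x0 \<le> q x0" using p0 q by (simp add: divide_le_eq mult_le_cancel_left1)
      then show "q x0 / p x0 - 1 \<le> Q" using q by simp
    qed
    finally show ?thesis .
  qed
  have "R j powr (- (n / q x0) * q x) = (R j powr n) powr ((q x0 - q x) / q x0) * R j powr (- n)"
    using q by (simp add: powr_powr flip: powr_add) (simp add: field_simps)
  moreover have "spread g j powr (1 / p x0 * q x)
      = spread g j powr ((q x - q x0) / p x0) * spread g j powr (q x0 / p x0 - 1) * spread g j"
  proof -
    have "1 / p x0 * q x = (q x - q x0) / p x0 + (q x0 / p x0 - 1) + 1" using p0 by (simp add: field_simps)
    then show ?thesis using v by (simp only: powr_add powr_one)
  qed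
  ultimately have "(R j powr (- (n / q x0)) * spread g j powr (1 / p x0)) powr q x
    = ((R j powr n) powr ((q x0 - q x) / q x0) * (spread g j powr ((q x - q x0) / p x0) * spread g j powr (q x0 / p x0 - 1)))
        * (R j powr (- n) * spread g j)"
    by (simp add: powr_mult powr_powr)
  also have "\<dots> \<le> C_power * (R j powr (- n) * spread g j)"
    unfolding C_power_def using v 1 2 3 by (intro mult_right_mono mult_mono) auto
  finally show ?thesis .
qed

end

section \<open>The weighted modular inequality\<close>

lemma ennreal_powr_mono: "x \<le> y \<Longrightarrow> 0 \<le> r \<Longrightarrow> ennreal_powr x r \<le> ennreal_powr y r"
  by (cases x; cases y) (auto simp: ennreal_powr_def top_unique intro!: ennreal_leI powr_mono2)

lemma ennreal_powr_divide_le: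
  assumes "1 \<le> K" "1 \<le> r"
  shows "ennreal_powr (z / ennreal K) r \<le> ennreal_powr z r / ennreal K"
proof (cases z)
  case top
  then show ?thesis using assms by (simp add: ennreal_powr_def ennreal_top_divide)
next
  case (real t)
  have "K powr 1 \<le> K powr r" using assms by (intro powr_mono) auto
  then have "t powr r / K powr r \<le> t powr r / K"
    using assms real by (intro divide_left_mono) auto
  then have "(t / K) powr r \<le> t powr r / K" using real assms by (simp add: powr_divide)
  then show ?thesis
    using real assms by (simp add: ennreal_powr_def divide_ennreal ennreal_leI)
qed

lemma borel_measurable_ennreal_powr [measurable]:
  assumes f[measurable]: "f \<in> borel_measurable M"
  shows "(\<lambda>x. ennreal_powr (f x) r) \<in> borel_measurable M"
proof -
  have [measurable]: "(\<lambda>t::real. t powr r) \<in> borel_measurable borel" by simp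
  have "(\<lambda>x. ennreal (enn2real (f x) powr r)) \<in> borel_measurable M" by measurable
  moreover have "{x \<in> space M. f x = \<infinity>} = f -` {\<infinity>} \<inter> space M" by auto
  then have "{x \<in> space M. f x = \<infinity>} \<in> sets M" by (simp add: measurable_sets[OF f])
  ultimately show ?thesis
    unfolding ennreal_powr_def by (intro measurable_If) auto
qed

lemma powr_add_le:
  fixes a b r :: real
  assumes "0 \<le> a" "0 \<le> b" "0 \<le> r"
  shows "(a + b) powr r \<le> 2 powr r * (a powr r + b powr r)"
proof -
  have "(a + b) powr r \<le> (2 * max a b) powr r" using assms by (intro powr_mono2) auto
  also have "\<dots> = 2 powr r * (max a b) powr r" using assms by (simp add: powr_mult)
  also have "\<dots> \<le> 2 powr r * (a powr r + b powr r)" by (intro mult_left_mono) (auto simp: max_def)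
  finally show ?thesis .
qed

definition frac_maximal_ball :: "real \<Rightarrow> ('a::euclidean_space \<Rightarrow> real) \<Rightarrow> 'a \<Rightarrow> ennreal" where
  "frac_maximal_ball \<alpha> f x = (SUP \<rho>\<in>{0<..}.
     ennreal (\<rho> powr (\<alpha> - real DIM('a))) * (\<integral>\<^sup>+y\<in>ball x \<rho>. ennreal \<bar>f y\<bar> \<partial>lebesgue))"

context power_weight_exponents
begin

definition "B_local = 2 * D powr n + 1 / \<omega>"
definition "C_local = (1 + B_local powr P * K powr n) * B_local * \<omega>"

lemma C_local_pos: "0 < C_local"
proof -
  have "0 < 1 / \<omega>" using \<omega>_pos by simp
  then have "0 < B_local" using Dn_ge_1 unfolding B_local_def by linarith
  moreover have "0 < 1 + B_local powr P * K powr n" by (intro add_pos_nonneg) auto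
  ultimately show ?thesis using \<omega>_pos by (simp add: C_local_def)
qed

lemma C_global_pos: "0 < C_global"
  unfolding C_global_def using C_shell_pos decay by (intro mult_pos_pos add_nonneg_pos) auto

text \<open>
  The combination of both regimes.  For \<open>\<rho> < d / 2\<close> every point of the ball has distance between
  \<open>d / 2\<close> and \<open>3 d / 2\<close> from \<open>x\<^sub>0\<close>, so the weight can be taken inside the integral.
\<close>

lemma weighted_average_le:
  assumes g: "unit_modular g" and f: "\<And>y. g y = w y * \<bar>f y\<bar>" "f \<in> borel_measurable lebesgue"
    and x: "x \<in> shell j" and \<rho>: "0 < \<rho>"
    and m: "0 \<le> m" "HL_maximal D (\<lambda>y. ennreal (g y powr (p y / s) * indicator \<Omega> y)) x \<le> ennreal m"
  shows "ennreal (w x * \<rho> powr (\<alpha> - n)) * (\<integral>\<^sup>+y\<in>ball x \<rho>. ennreal \<bar>f y\<bar> \<partial>lebesgue)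
    \<le> ennreal (2 powr \<bar>\<eta>\<bar> * C_local * (1 + m) powr (s / q x) +
         3 powr n * C_global * (R j powr (- (n / q x0)) * spread g j powr (1 / p x0)))"
proof -
  note [measurable] = f(2)
  have [measurable]: "g \<in> borel_measurable lebesgue" using g by (simp add: unit_modular_def)
  define d where "d = norm (x - x0)"
  have xO: "x \<in> \<Omega>" using x by (simp add: shell_def)
  have "R (Suc j) < d" using x by (simp add: shell_def d_def)
  then have d: "0 < d" "d \<le> D"
    using R_pos[of "Suc j"] diameter[OF xO x0_in] by (auto simp: d_def)
  have w0: "0 \<le> w x" by (simp add: w_def)
  have [measurable]: "ball x \<rho> \<in> sets lebesgue" by simp
  show ?thesis
  proof (cases "\<rho> < d / 2")
    case True
    have "ennreal (w x * \<rho> powr (\<alpha> - n)) * (\<integral>\<^sup>+y\<in>ball x \<rho>. ennreal \<bar>f y\<bar> \<partial>lebesgue)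
       = ennreal (\<rho> powr (\<alpha> - n)) * (\<integral>\<^sup>+y. ennreal (w x) * (ennreal \<bar>f y\<bar> * indicator (ball x \<rho>) y) \<partial>lebesgue)"
      using w0 by (subst nn_integral_cmult) (simp_all add: ennreal_mult' mult_ac)
    also have "\<dots> \<le> ennreal (\<rho> powr (\<alpha> - n)) * (\<integral>\<^sup>+y. ennreal (2 powr \<bar>\<eta>\<bar>) * (ennreal (g y) * indicator (ball x \<rho>) y) \<partial>lebesgue)"
    proof (intro mult_left_mono nn_integral_mono)
      fix y
      have "w x * \<bar>f y\<bar> \<le> 2 powr \<bar>\<eta>\<bar> * g y" if "y \<in> ball x \<rho>"
      proof -
        define t where "t = norm (y - x0)"
        have xy: "norm (x - y) < d / 2" using that True by (simp add: dist_norm)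
        have "d \<le> norm (x - y) + t" "t \<le> norm (x - y) + d"
          using norm_triangle_ineq[of "x - y" "y - x0"] norm_triangle_ineq[of "y - x" "x - x0"]
          by (auto simp: d_def t_def norm_minus_commute)
        then have "t / 2 \<le> d" "d \<le> 2 * t" "0 < t" using xy d by auto
        then have "d powr \<eta> \<le> 2 powr \<bar>\<eta>\<bar> * t powr \<eta>" by (rule powr_le_of_comparable)
        then have "w x \<le> 2 powr \<bar>\<eta>\<bar> * w y" by (simp add: w_def d_def t_def)
        then have "w x * \<bar>f y\<bar> \<le> 2 powr \<bar>\<eta>\<bar> * w y * \<bar>f y\<bar>" by (rule mult_right_mono) simp
        then show ?thesis by (simp add: f(1) mult.assoc)
      qed
      then show "ennreal (w x) * (ennreal \<bar>f y\<bar> * indicator (ball x \<rho>) y)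
         \<le> ennreal (2 powr \<bar>\<eta>\<bar>) * (ennreal (g y) * indicator (ball x \<rho>) y)"
        using w0 by (auto split: split_indicator simp: ennreal_mult'[symmetric] intro!: ennreal_leI)
    qed simp
    also have "\<dots> = ennreal (\<rho> powr (\<alpha> - n)) * (ennreal (2 powr \<bar>\<eta>\<bar>) * (\<integral>\<^sup>+y\<in>ball x \<rho>. ennreal (g y) \<partial>lebesgue))"
      by (subst nn_integral_cmult) simp_all
    also have "\<dots> \<le> ennreal (\<rho> powr (\<alpha> - n)) * (ennreal (2 powr \<bar>\<eta>\<bar>) *
        ennreal (C_local * \<rho> powr (n - \<alpha>) * (1 + m) powr (s / q x)))"
      unfolding C_local_def using True d
      by (intro mult_left_mono local_fractional_average_le xO \<rho> g m B_local_def) auto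
    also have "\<dots> = ennreal (2 powr \<bar>\<eta>\<bar> * C_local * (1 + m) powr (s / q x))"
    proof -
      have "\<rho> powr (\<alpha> - n) * \<rho> powr (n - \<alpha>) = 1" using \<rho> by (simp flip: powr_add)
      moreover have "\<rho> powr (\<alpha> - n) * (2 powr \<bar>\<eta>\<bar> * (C_local * \<rho> powr (n - \<alpha>) * (1 + m) powr (s / q x)))
         = (\<rho> powr (\<alpha> - n) * \<rho> powr (n - \<alpha>)) * (2 powr \<bar>\<eta>\<bar> * C_local * (1 + m) powr (s / q x))"
        by (simp only: mult_ac)
      ultimately show ?thesis by (simp only: ennreal_mult'[symmetric] powr_ge_zero mult_1)
    qed
    also have "\<dots> \<le> ennreal (2 powr \<bar>\<eta>\<bar> * C_local * (1 + m) powr (s / q x) +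
         3 powr n * C_global * (R j powr (- (n / q x0)) * spread g j powr (1 / p x0)))"
      using C_global_pos by (intro ennreal_leI) simp
    finally show ?thesis .
  next
    case False
    have "ball x \<rho> \<subseteq> ball x0 (3 * \<rho>)"
    proof
      fix y assume "y \<in> ball x \<rho>"
      then have "dist x y < \<rho>" by simp
      moreover have "dist x0 y \<le> dist x0 x + dist x y" by (rule dist_triangle)
      moreover have "dist x0 x = d" by (simp add: d_def dist_norm norm_minus_commute)
      ultimately show "y \<in> ball x0 (3 * \<rho>)" using False by simp
    qed
    then have int_le: "(\<integral>\<^sup>+y\<in>ball x \<rho>. ennreal \<bar>f y\<bar> \<partial>lebesgue) \<le> (\<integral>\<^sup>+y\<in>ball x0 (3 * \<rho>). ennreal \<bar>f y\<bar> \<partial>lebesgue)"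
      by (intro nn_integral_mono) (auto split: split_indicator)
    have weight_le: "w x * \<rho> powr (\<alpha> - n) \<le> 3 powr n * (w x * (3 * \<rho>) powr (\<alpha> - n))"
    proof -
      have "1 \<le> 3 powr n * 3 powr (\<alpha> - n)"
        using \<alpha>_nonneg by (simp add: ge_one_powr_ge_zero flip: powr_add)
      then have "1 * (w x * \<rho> powr (\<alpha> - n)) \<le> 3 powr n * 3 powr (\<alpha> - n) * (w x * \<rho> powr (\<alpha> - n))"
        using w0 by (intro mult_right_mono) auto
      then show ?thesis using \<rho> by (simp add: powr_mult mult_ac)
    qed
    have "ennreal (w x * \<rho> powr (\<alpha> - n)) * (\<integral>\<^sup>+y\<in>ball x \<rho>. ennreal \<bar>f y\<bar> \<partial>lebesgue)
      \<le> ennreal (3 powr n * (w x * (3 * \<rho>) powr (\<alpha> - n))) * (\<integral>\<^sup>+y\<in>ball x0 (3 * \<rho>). ennreal \<bar>f y\<bar> \<partial>lebesgue)"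
      by (rule mult_mono[OF ennreal_leI[OF weight_le] int_le]) simp_all
    also have "\<dots> = ennreal (3 powr n) * (ennreal (w x * (3 * \<rho>) powr (\<alpha> - n)) * (\<integral>\<^sup>+y\<in>ball x0 (3 * \<rho>). ennreal \<bar>f y\<bar> \<partial>lebesgue))"
      by (simp add: ennreal_mult' mult.assoc)
    also have "\<dots> \<le> ennreal (3 powr n) * ennreal (C_global * (R j powr (- (n / q x0)) * spread g j powr (1 / p x0)))"
      using False d \<rho> by (intro mult_left_mono global_fractional_average_le g f x) (auto simp: d_def)
    also have "\<dots> = ennreal (3 powr n * C_global * (R j powr (- (n / q x0)) * spread g j powr (1 / p x0)))"
      by (simp add: ennreal_mult'[symmetric] mult.assoc)
    also have "\<dots> \<le> ennreal (2 powr \<bar>\<eta>\<bar> * C_local * (1 + m) powr (s / q x) +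
         3 powr n * C_global * (R j powr (- (n / q x0)) * spread g j powr (1 / p x0)))"
      using C_local_pos by (intro ennreal_leI) simp
    finally show ?thesis .
  qed
qed

definition "C_pointwise =
  (2 * (1 + 2 powr \<bar>\<eta>\<bar> * C_local + 3 powr n * C_global)) powr Q * (2 powr s + C_power)"

lemma C_pointwise_pos: "0 < C_pointwise"
proof -
  have "0 < 1 + 2 powr \<bar>\<eta>\<bar> * C_local + 3 powr n * C_global"
    using C_local_pos C_global_pos by (intro add_pos_pos) auto
  moreover have "0 \<le> C_power" by (simp add: C_power_def)
  moreover have "0 < (2::real) powr s" by simp
  ultimately show ?thesis unfolding C_pointwise_def by (intro mult_pos_pos add_pos_nonneg) auto
qed

text \<open>
  The supremum over the radii is taken before the power \<open>q x\<close>, as the bound for the averages is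
  uniform in the radius.
\<close>

lemma weighted_maximal_power_le:
  assumes g: "unit_modular g" and f: "\<And>y. g y = w y * \<bar>f y\<bar>" "f \<in> borel_measurable lebesgue"
    and x: "x \<in> shell j"
  shows "ennreal_powr (ennreal (w x) * frac_maximal_ball \<alpha> f x) (q x)
    \<le> ennreal C_pointwise *
        ((1 + ennreal_powr (HL_maximal D (\<lambda>y. ennreal (g y powr (p y / s) * indicator \<Omega> y)) x) s)
          + ennreal (R j powr (- n) * spread g j))"
    (is "_ \<le> _ * ((1 + ennreal_powr ?Z s) + _)")
proof (cases ?Z)
  case top
  then have "ennreal C_pointwise * ((1 + ennreal_powr ?Z s) + ennreal (R j powr (- n) * spread g j)) = top"
    using C_pointwise_pos by (simp add: ennreal_powr_def ennreal_mult_top)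
  then show ?thesis by simp
next
  case (real m)
  have xO: "x \<in> \<Omega>" using x by (simp add: shell_def)
  have q: "0 < q x" "q x \<le> Q" using q_pos[OF xO] q_le[OF xO] by auto
  define c where "c = 1 + 2 powr \<bar>\<eta>\<bar> * C_local + 3 powr n * C_global"
  have c: "0 \<le> 2 powr \<bar>\<eta>\<bar> * C_local" "0 \<le> 3 powr n * C_global"
    using C_local_pos C_global_pos by auto
  then have c1: "1 \<le> c" "2 powr \<bar>\<eta>\<bar> * C_local \<le> c" "3 powr n * C_global \<le> c" unfolding c_def by auto
  define X where "X = (1 + m) powr (s / q x)"
  define Y where "Y = R j powr (- (n / q x0)) * spread g j powr (1 / p x0)"
  have XY: "0 \<le> X" "0 \<le> Y" by (auto simp: X_def Y_def)
  have "ennreal (w x) * frac_maximal_ball \<alpha> f x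
     = (SUP \<rho>\<in>{0<..}. ennreal (w x) * (ennreal (\<rho> powr (\<alpha> - n)) * (\<integral>\<^sup>+y\<in>ball x \<rho>. ennreal \<bar>f y\<bar> \<partial>lebesgue)))"
    unfolding frac_maximal_ball_def n_def by (rule SUP_mult_left_ennreal) 
  also have "\<dots> \<le> ennreal (c * (X + Y))"
  proof (rule SUP_least)
    fix \<rho> :: real assume "\<rho> \<in> {0<..}"
    then have \<rho>: "0 < \<rho>" by simp
    have "ennreal (w x) * (ennreal (\<rho> powr (\<alpha> - n)) * (\<integral>\<^sup>+y\<in>ball x \<rho>. ennreal \<bar>f y\<bar> \<partial>lebesgue))
       = ennreal (w x * \<rho> powr (\<alpha> - n)) * (\<integral>\<^sup>+y\<in>ball x \<rho>. ennreal \<bar>f y\<bar> \<partial>lebesgue)"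
      by (simp add: ennreal_mult'' mult.assoc)
    also have "\<dots> \<le> ennreal (2 powr \<bar>\<eta>\<bar> * C_local * X + 3 powr n * C_global * Y)"
      unfolding X_def Y_def by (rule weighted_average_le[OF g f x \<rho>]) (use real in auto)
    also have "\<dots> \<le> ennreal (c * X + c * Y)"
      using c1 XY by (intro ennreal_leI add_mono mult_right_mono) auto
    finally show "ennreal (w x) * (ennreal (\<rho> powr (\<alpha> - n)) * (\<integral>\<^sup>+y\<in>ball x \<rho>. ennreal \<bar>f y\<bar> \<partial>lebesgue))
       \<le> ennreal (c * (X + Y))" by (simp only: distrib_left)
  qed
  finally have "ennreal_powr (ennreal (w x) * frac_maximal_ball \<alpha> f x) (q x) \<le> ennreal_powr (ennreal (c * (X + Y))) (q x)"
    using q by (intro ennreal_powr_mono) auto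
  also have "\<dots> = ennreal ((c * (X + Y)) powr q x)"
    using c1 XY by (simp add: ennreal_powr_def)
  also have "\<dots> \<le> ennreal (C_pointwise * ((1 + m powr s) + R j powr (- n) * spread g j))"
  proof (rule ennreal_leI)
    have Xq: "X powr q x \<le> 2 powr s * (1 + m powr s)"
      using powr_add_le[of 1 m s] real s_gt_1 q by (simp add: X_def powr_powr)
    have Yq: "Y powr q x \<le> C_power * (R j powr (- n) * spread g j)"
      unfolding Y_def by (rule shell_power_le[OF g x])
    have Cp: "0 \<le> C_power" by (simp add: C_power_def)
    have v0: "0 \<le> R j powr (- n) * spread g j" using spread_bounds(4)[OF g, of j] by simp
    have "(c * (X + Y)) powr q x = c powr q x * (X + Y) powr q x"
      using c1 XY by (simp add: powr_mult)
    also have "\<dots> \<le> c powr q x * (2 powr q x * (X powr q x + Y powr q x))"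
      using XY q by (intro mult_left_mono powr_add_le) auto
    also have "\<dots> = (2 * c) powr q x * (X powr q x + Y powr q x)"
      using c1 by (simp add: powr_mult)
    also have "\<dots> \<le> (2 * c) powr Q * (X powr q x + Y powr q x)"
      using c1 q by (intro mult_right_mono powr_mono) auto
    also have "\<dots> \<le> (2 * c) powr Q * ((2 powr s + C_power) * ((1 + m powr s) + R j powr (- n) * spread g j))"
    proof (intro mult_left_mono)
      have "X powr q x + Y powr q x \<le> 2 powr s * (1 + m powr s) + C_power * (R j powr (- n) * spread g j)"
        by (rule add_mono[OF Xq Yq])
      also have "\<dots> \<le> (2 powr s + C_power) * ((1 + m powr s) + R j powr (- n) * spread g j)"
      proof -
        have "0 \<le> C_power * (1 + m powr s)" "0 \<le> 2 powr s * (R j powr (- n) * spread g j)"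
          using Cp v0 by (auto intro!: mult_nonneg_nonneg)
        then show ?thesis unfolding distrib_left distrib_right by linarith
      qed
      finally show "X powr q x + Y powr q x \<le> (2 powr s + C_power) * ((1 + m powr s) + R j powr (- n) * spread g j)" .
    qed simp
    finally show "(c * (X + Y)) powr q x \<le> C_pointwise * ((1 + m powr s) + R j powr (- n) * spread g j)"
      by (simp add: C_pointwise_def c_def mult.assoc)
  qed
  also have "\<dots> = ennreal C_pointwise * ((1 + ennreal_powr ?Z s) + ennreal (R j powr (- n) * spread g j))"
  proof -
    have "0 \<le> R j powr (- n) * spread g j" using spread_bounds(4)[OF g, of j] by simp
    then show ?thesis using C_pointwise_pos real
      by (simp add: ennreal_mult' ennreal_powr_def ennreal_plus)
  qed
  finally show ?thesis .
qed

text \<open>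
  The constant \<open>L\<close> divides the integrand instead of the integral: the estimate is pointwise up to a
  measurable majorant, and constants are moved across the integral sign for that majorant only.
\<close>

theorem weighted_ball_maximal_modular:
  obtains L where "1 \<le> L"
    and "\<And>g f. \<lbrakk>unit_modular g; \<And>y. g y = w y * \<bar>f y\<bar>; f \<in> borel_measurable lebesgue\<rbrakk> \<Longrightarrow>
      (\<integral>\<^sup>+x\<in>\<Omega>. ennreal_powr (ennreal (w x) * frac_maximal_ball \<alpha> f x) (q x) / ennreal L \<partial>lebesgue) \<le> 1"
proof -
  obtain H where H: "0 \<le> H"
    and strong: "\<And>R E h. \<lbrakk>h \<in> borel_measurable lebesgue; \<And>y. 0 \<le> h y; E \<in> sets lebesgue\<rbrakk> \<Longrightarrow>
      (\<integral>\<^sup>+x\<in>E. ennreal_powr (HL_maximal R (\<lambda>y. ennreal (h y)) x) s \<partial>lebesgue)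
        \<le> emeasure lebesgue E
           + ennreal H * (\<integral>\<^sup>+y. ennreal (h y powr s) \<partial>(lebesgue :: 'a measure))"
    using HL_maximal_strong_type[OF s_gt_1] by blast
  define W where "W = \<omega> * D powr n"
  have W0: "0 \<le> W" using \<omega>_pos by (simp add: W_def)
  have em\<Omega>: "emeasure lebesgue \<Omega> \<le> ennreal W"
  proof -
    have "emeasure lebesgue \<Omega> \<le> emeasure lebesgue (cball x0 D)"
      using diameter x0_in by (intro emeasure_mono) (auto simp: dist_norm)
    also have "\<dots> = ennreal W"
      using D_ge_1 by (simp add: emeasure_cball W_def \<omega>_def n_def powr_realpow)
    finally show ?thesis .
  qed
  define G where "G = \<omega> * (U * (2 / (1 - decay)))"
  have G0: "0 \<le> G" using \<omega>_pos U_ge decay by (simp add: G_def)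
  define L where "L = 1 + C_pointwise * (W + (W + H) + G)"
  have L0: "0 \<le> C_pointwise * (W + (W + H) + G)"
    using C_pointwise_pos W0 H G0 by simp
  have L1: "1 \<le> L" using L0 by (simp add: L_def)
  moreover have "(\<integral>\<^sup>+x\<in>\<Omega>. ennreal_powr (ennreal (w x) * frac_maximal_ball \<alpha> f x) (q x) / ennreal L \<partial>lebesgue) \<le> 1"
    if g: "unit_modular g" and f: "\<And>y. g y = w y * \<bar>f y\<bar>" "f \<in> borel_measurable lebesgue" for g f
  proof -
    define h where "h y = g y powr (p y / s) * indicator \<Omega> y" for y
    have g': "g \<in> borel_measurable lebesgue" "\<And>y. 0 \<le> g y"
      "(\<integral>\<^sup>+y\<in>\<Omega>. ennreal (g y powr p y) \<partial>lebesgue) \<le> 1"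
      using g by (auto simp: unit_modular_def)
    have h[measurable]: "h \<in> borel_measurable lebesgue"
      unfolding h_def by (rule powr_p_measurable[OF g'(1) _ sets_\<Omega>]) simp
    have h0: "0 \<le> h y" for y by (simp add: h_def)
    define Z where "Z = HL_maximal D (\<lambda>y. ennreal (h y))"
    have [measurable]: "Z \<in> borel_measurable lebesgue" unfolding Z_def by measurable
    note [measurable] = sets_\<Omega>
    have "(\<integral>\<^sup>+y. ennreal (h y powr s) \<partial>lebesgue) = (\<integral>\<^sup>+y\<in>\<Omega>. ennreal (g y powr p y) \<partial>lebesgue)"
      using s_gt_1 by (intro nn_integral_cong) (auto simp: h_def powr_powr split: split_indicator)
    with g'(3) have "ennreal H * (\<integral>\<^sup>+y. ennreal (h y powr s) \<partial>lebesgue) \<le> ennreal H * 1"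
      by (intro mult_left_mono) auto
    then have "(\<integral>\<^sup>+x\<in>\<Omega>. ennreal_powr (Z x) s \<partial>lebesgue) \<le> emeasure lebesgue \<Omega> + ennreal H * 1"
      unfolding Z_def by (rule order_trans[OF strong[OF h h0 sets_\<Omega>] add_left_mono])
    also have "\<dots> \<le> ennreal (W + H)" using em\<Omega> W0 H by (simp add: add_right_mono)
    finally have Zs: "(\<integral>\<^sup>+x\<in>\<Omega>. ennreal_powr (Z x) s \<partial>lebesgue) \<le> ennreal (W + H)" .
    define T where "T x = (\<Sum>j. ennreal (R j powr (- n) * spread g j) * indicator (shell j) x)" for x
    have [measurable]: "T \<in> borel_measurable lebesgue" unfolding T_def by measurable
    have "(\<integral>\<^sup>+x. T x \<partial>lebesgue) = (\<Sum>j. ennreal (R j powr (- n) * spread g j) * emeasure lebesgue (shell j))"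
      unfolding T_def by (subst nn_integral_suminf) (simp_all add: nn_integral_cmult_indicator del: emeasure_completion)
    also have "\<dots> \<le> (\<Sum>j. ennreal \<omega> * ennreal (spread g j))"
    proof (intro suminf_le)
      fix j
      have "ennreal (R j powr (- n) * spread g j) * emeasure lebesgue (shell j)
         \<le> ennreal (R j powr (- n) * spread g j) * ennreal (\<omega> * R j powr n)"
        by (intro mult_left_mono emeasure_shell) simp
      also have "\<dots> = ennreal ((R j powr (- n) * R j powr n) * (\<omega> * spread g j))"
        using spread_bounds(4)[OF g, of j] \<omega>_pos by (simp add: ennreal_mult'[symmetric] mult_ac)
      also have "R j powr (- n) * R j powr n = 1" using R_pos[of j] by (simp flip: powr_add)
      finally show "ennreal (R j powr (- n) * spread g j) * emeasure lebesgue (shell j) \<le> ennreal \<omega> * ennreal (spread g j)"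
        using \<omega>_pos by (simp add: ennreal_mult')
    qed auto
    also have "\<dots> = ennreal \<omega> * (\<Sum>j. ennreal (spread g j))" by simp
    also have "\<dots> \<le> ennreal \<omega> * ennreal (U * (2 / (1 - decay)))"
      by (intro mult_left_mono spread_bounds(5)[OF g]) simp
    also have "\<dots> = ennreal G" using \<omega>_pos by (simp add: G_def ennreal_mult'[symmetric])
    finally have Ts: "(\<integral>\<^sup>+x. T x \<partial>lebesgue) \<le> ennreal G" .
    have "(\<integral>\<^sup>+x\<in>\<Omega>. ennreal_powr (ennreal (w x) * frac_maximal_ball \<alpha> f x) (q x) / ennreal L \<partial>lebesgue)
       \<le> (\<integral>\<^sup>+x. ennreal C_pointwise * ((indicator \<Omega> x + ennreal_powr (Z x) s * indicator \<Omega> x) + T x) / ennreal L \<partial>lebesgue)"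
    proof (rule nn_integral_mono)
      fix x
      have "ennreal_powr (ennreal (w x) * frac_maximal_ball \<alpha> f x) (q x) * indicator \<Omega> x
        \<le> ennreal C_pointwise * ((indicator \<Omega> x + ennreal_powr (Z x) s * indicator \<Omega> x) + T x)"
      proof (cases "x \<in> \<Omega> \<and> x \<noteq> x0")
        case True
        then obtain j where j: "x \<in> shell j" using ex_shell by blast
        define F where "F j = ennreal (R j powr (- n) * spread g j) * indicator (shell j) x" for j
        have "ennreal (R j powr (- n) * spread g j) = F j" using j by (simp add: F_def)
        also have "\<dots> \<le> (\<Sum>j. F j)" using sum_le_suminf[of F "{j}"] by simp
        also have "\<dots> = T x" by (simp add: T_def F_def)
        finally have "ennreal (R j powr (- n) * spread g j) \<le> T x" .
        then have "ennreal C_pointwise * ((1 + ennreal_powr (Z x) s) + ennreal (R j powr (- n) * spread g j))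
           \<le> ennreal C_pointwise * ((1 + ennreal_powr (Z x) s) + T x)"
          by (intro mult_left_mono add_left_mono) auto
        then show ?thesis
          using weighted_maximal_power_le[OF g f j] True unfolding Z_def h_def
          by (simp add: order_trans)
      next
        case False
        \<comment> \<open>At \<open>x\<^sub>0\<close> the weight vanishes, as \<open>0 powr \<eta> = 0\<close>.\<close>
        then have "ennreal_powr (ennreal (w x) * frac_maximal_ball \<alpha> f x) (q x) * indicator \<Omega> x = 0"
          by (auto simp: w_def ennreal_powr_def split: split_indicator)
        then show ?thesis by (simp only: zero_le)
      qed
      from divide_right_mono_ennreal[OF this, of "ennreal L"]
      show "ennreal_powr (ennreal (w x) * frac_maximal_ball \<alpha> f x) (q x) / ennreal L * indicator \<Omega> x
        \<le> ennreal C_pointwise * ((indicator \<Omega> x + ennreal_powr (Z x) s * indicator \<Omega> x) + T x) / ennreal L"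
        unfolding divide_ennreal_def by (simp only: mult_ac)
    qed
    also have "\<dots> = ennreal C_pointwise * ((emeasure lebesgue \<Omega> + (\<integral>\<^sup>+x\<in>\<Omega>. ennreal_powr (Z x) s \<partial>lebesgue)) + (\<integral>\<^sup>+x. T x \<partial>lebesgue)) / ennreal L"
    proof -
      define F where "F x = (indicator \<Omega> x + ennreal_powr (Z x) s * indicator \<Omega> x) + T x" for x
      have [measurable]: "F \<in> borel_measurable lebesgue" unfolding F_def by measurable
      have "(\<integral>\<^sup>+x. F x \<partial>lebesgue)
          = (emeasure lebesgue \<Omega> + (\<integral>\<^sup>+x\<in>\<Omega>. ennreal_powr (Z x) s \<partial>lebesgue)) + (\<integral>\<^sup>+x. T x \<partial>lebesgue)"
        unfolding F_def by (simp add: nn_integral_add del: emeasure_completion)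
      moreover have "(\<integral>\<^sup>+x. ennreal C_pointwise * F x / ennreal L \<partial>lebesgue)
          = ennreal C_pointwise * (\<integral>\<^sup>+x. F x \<partial>lebesgue) / ennreal L"
        by (subst nn_integral_divide, measurable) (subst nn_integral_cmult, measurable)
      ultimately show ?thesis by (simp only: F_def)
    qed
    also have "\<dots> \<le> ennreal C_pointwise * ((ennreal W + ennreal (W + H)) + ennreal G) / ennreal L"
      by (intro divide_right_mono_ennreal mult_left_mono add_mono em\<Omega> Zs Ts) simp
    also have "\<dots> = ennreal (C_pointwise * (W + (W + H) + G)) / ennreal L"
      using W0 H G0 C_pointwise_pos
      by (simp only: ennreal_plus[symmetric] add_nonneg_nonneg ennreal_mult'[symmetric] less_imp_le)
    also have "\<dots> \<le> 1"
    proof -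
      have "C_pointwise * (W + (W + H) + G) / L \<le> 1" using L1 by (simp add: L_def)
      then show ?thesis using L0 L1 by (subst divide_ennreal) (simp_all del: ennreal_plus)
    qed
    finally show ?thesis .
  qed
  ultimately show ?thesis by (rule that)
qed

end

section \<open>From balls to cubes and from modulars to norms\<close>

lemma cube_subset_ball:
  fixes x :: "real ^ 'n"
  assumes "0 < r"
  shows "cube x r \<subseteq> ball x (real CARD('n) * r)"
proof
  fix y assume y: "y \<in> cube x r"
  have "\<bar>(x - y) $ i\<bar> \<le> r / 2" for i
  proof -
    have "x $ i - r / 2 \<le> y $ i" "y $ i \<le> x $ i + r / 2"
      using y by (auto simp: cube_def mem_box_cart)
    then show ?thesis unfolding vector_minus_component abs_le_iff by linarith
  qed
  then have "(\<Sum>i\<in>UNIV. \<bar>(x - y) $ i\<bar>) \<le> (\<Sum>i\<in>(UNIV::'n set). r / 2)" by (intro sum_mono)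
  then have "norm (x - y) \<le> real CARD('n) * (r / 2)"
    using norm_le_l1_cart[of "x - y"] by simp
  also have "\<dots> < real CARD('n) * r" using assms by simp
  finally show "y \<in> ball x (real CARD('n) * r)" by (simp add: dist_norm)
qed

lemma measure_cube:
  fixes x :: "real ^ 'n"
  assumes "0 < r"
  shows "measure lebesgue (cube x r) = r ^ CARD('n)"
proof -
  have "measure lebesgue (cube x r) = measure lborel (cube x r)"
    by (simp add: cube_def)
  also have "\<dots> = (\<Prod>i\<in>(UNIV :: 'n set). r)"
    unfolding cube_def using assms
    by (subst content_cbox_cart) (auto simp: interval_eq_empty_cart not_less)
  finally show ?thesis by simp
qed

lemma INF_mult_le_ennreal:
  assumes "0 < C"
  shows "(INF i\<in>I. ennreal C * f i) \<le> ennreal C * (INF i\<in>I. f i)"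
proof -
  define X where "X = (INF i\<in>I. ennreal C * f i)"
  have "X / ennreal C \<le> f i" if "i \<in> I" for i
  proof -
    have "X \<le> ennreal C * f i" unfolding X_def using that by (rule INF_lower)
    then have "X / ennreal C \<le> f i * ennreal C / ennreal C"
      by (intro divide_right_mono_ennreal) (simp add: mult.commute)
    then show ?thesis using assms by (simp add: mult_divide_eq_ennreal)
  qed
  then have "ennreal C * (X / ennreal C) \<le> ennreal C * (INF i\<in>I. f i)"
    by (intro mult_left_mono INF_greatest) auto
  moreover have "ennreal C * (X / ennreal C) = X"
    using assms by (simp add: ennreal_times_divide mult.commute[of _ X] mult_divide_eq_ennreal)
  ultimately show ?thesis by (simp add: X_def)
qed

text \<open>
  The cube of side \<open>r\<close> is compared with the ball of radius \<open>n r\<close>; the loss \<open>n\<^bsup>n - \<alpha>\<^esup>\<close> in the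
  normalization is rounded up to \<open>n\<^sup>n\<close>.
\<close>

lemma frac_maximal_le_frac_maximal_ball:
  fixes f :: "real ^ 'n \<Rightarrow> real"
  assumes \<alpha>: "0 \<le> \<alpha>" and n_def: "n = real CARD('n)"
  shows "frac_maximal \<alpha> f x \<le> ennreal (n powr n) * frac_maximal_ball \<alpha> f x"
proof -
  have n1: "1 \<le> n" by (simp add: n_def)
  have DIM: "real DIM(real ^ 'n) = n" by (simp add: n_def)
  show ?thesis
    unfolding frac_maximal_def
  proof (rule SUP_least)
    fix r :: real assume "r \<in> {0<..}"
    then have r: "0 < r" by simp
    define J where "J = (\<integral>\<^sup>+y\<in>ball x (n * r). ennreal \<bar>f y\<bar> \<partial>lebesgue)"
    have meas: "measure lebesgue (cube x r) powr (1 - \<alpha> / real CARD('n)) = r powr (n - \<alpha>)"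
    proof -
      have "n * (1 - \<alpha> / n) = n - \<alpha>" using n1 by (simp add: right_diff_distrib)
      then show ?thesis
        unfolding measure_cube[OF r] powr_realpow[OF r, symmetric] powr_powr n_def by simp
    qed
    have "(\<integral>\<^sup>+y\<in>cube x r. ennreal \<bar>f y\<bar> \<partial>lebesgue) \<le> (\<integral>\<^sup>+y\<in>ball x (n * r). ennreal \<bar>f y\<bar> \<partial>lebesgue)"
      using cube_subset_ball[OF r, of x] unfolding n_def[symmetric]
      by (intro nn_integral_mono) (auto split: split_indicator)
    also have "\<dots> = J" unfolding J_def ..
    finally have "(\<integral>\<^sup>+y\<in>cube x r. ennreal \<bar>f y\<bar> \<partial>lebesgue) / ennreal (r powr (n - \<alpha>))
       \<le> J / ennreal (r powr (n - \<alpha>))"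
      by (rule divide_right_mono_ennreal)
    also have "\<dots> = ennreal (r powr (\<alpha> - n)) * J"
      using r powr_minus[of r "n - \<alpha>"]
      by (simp add: divide_ennreal_def inverse_ennreal mult_ac)
    also have "\<dots> \<le> ennreal (n powr n * (n * r) powr (\<alpha> - n)) * J"
    proof (intro mult_right_mono ennreal_leI)
      have "1 \<le> n powr n * n powr (\<alpha> - n)"
        using n1 \<alpha> by (simp add: ge_one_powr_ge_zero flip: powr_add)
      then have "1 * r powr (\<alpha> - n) \<le> n powr n * n powr (\<alpha> - n) * r powr (\<alpha> - n)"
        by (intro mult_right_mono) auto
      then show "r powr (\<alpha> - n) \<le> n powr n * (n * r) powr (\<alpha> - n)"
        using n1 r by (simp add: powr_mult mult_ac)
    qed simp
    also have "\<dots> = ennreal (n powr n) * (ennreal ((n * r) powr (\<alpha> - n)) * J)"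
      by (simp add: ennreal_mult'' mult.assoc)
    also have "\<dots> \<le> ennreal (n powr n) * frac_maximal_ball \<alpha> f x"
      unfolding frac_maximal_ball_def J_def DIM using r n1
      by (intro mult_left_mono SUP_upper2[of "n * r"]) auto
    finally show "(\<integral>\<^sup>+y\<in>cube x r. ennreal \<bar>f y\<bar> \<partial>lebesgue) /
        ennreal (measure lebesgue (cube x r) powr (1 - \<alpha> / real CARD('n)))
       \<le> ennreal (n powr n) * frac_maximal_ball \<alpha> f x"
      unfolding meas .
  qed
qed

lemma frac_maximal_ball_divide:
  assumes f: "f \<in> borel_measurable lebesgue" and l: "0 < l"
  shows "frac_maximal_ball \<alpha> f x = ennreal l * frac_maximal_ball \<alpha> (\<lambda>y. f y / l) x"
proof -
  have "(\<integral>\<^sup>+y\<in>ball x \<rho>. ennreal \<bar>f y\<bar> \<partial>lebesgue)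
      = ennreal l * (\<integral>\<^sup>+y\<in>ball x \<rho>. ennreal \<bar>f y / l\<bar> \<partial>lebesgue)" for \<rho>
  proof -
    have [measurable]: "ball x \<rho> \<in> sets lebesgue" by simp
    note [measurable] = f
    have "(\<integral>\<^sup>+y\<in>ball x \<rho>. ennreal \<bar>f y\<bar> \<partial>lebesgue)
        = (\<integral>\<^sup>+y. ennreal l * (ennreal \<bar>f y / l\<bar> * indicator (ball x \<rho>) y) \<partial>lebesgue)"
      using l by (intro nn_integral_cong) (auto simp: ennreal_mult'[symmetric] split: split_indicator)
    then show ?thesis by (simp add: nn_integral_cmult)
  qed
  then show ?thesis
    unfolding frac_maximal_ball_def by (simp add: SUP_mult_left_ennreal mult.left_commute)
qed

lemma lux_norm_le_mult:
  assumes C: "0 < C"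
    and modular_le: "\<And>l. \<lbrakk>0 < l; modular p \<Omega> (\<lambda>x. u x / ennreal l) \<le> 1\<rbrakk>
      \<Longrightarrow> modular q \<Omega> (\<lambda>x. v x / ennreal (C * l)) \<le> 1"
  shows "lux_norm q \<Omega> v \<le> ennreal C * lux_norm p \<Omega> u"
proof -
  have "lux_norm q \<Omega> v \<le> ennreal (C * l)" if "0 < l" "modular p \<Omega> (\<lambda>x. u x / ennreal l) \<le> 1" for l
    unfolding lux_norm_def using C that modular_le by (intro INF_lower) auto
  then have "lux_norm q \<Omega> v
      \<le> (INF l\<in>{l. 0 < l \<and> modular p \<Omega> (\<lambda>x. u x / ennreal l) \<le> 1}. ennreal C * ennreal l)"
    using C by (intro INF_greatest) (auto simp: ennreal_mult'[symmetric])
  also have "\<dots> \<le> ennreal C * lux_norm p \<Omega> u"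
    unfolding lux_norm_def by (rule INF_mult_le_ennreal[OF C])
  finally show ?thesis .
qed

text \<open>
  Away from \<open>x\<^sub>0\<close> the weight can be divided out, and a single point does not affect measurability.
\<close>

lemma borel_measurable_of_power_weight:
  fixes f :: "'a::euclidean_space \<Rightarrow> real"
  assumes wf[measurable]: "(\<lambda>x. norm (x - x0) powr \<eta> * f x) \<in> borel_measurable lebesgue"
  shows "f \<in> borel_measurable lebesgue"
proof -
  have [measurable]: "{x0} \<in> sets lebesgue" by simp
  have [measurable]: "(\<lambda>x. norm (x - x0) powr (- \<eta>)) \<in> borel_measurable lebesgue"
    by (rule measurable_completion) measurable
  have "f = (\<lambda>x. if x \<in> {x0} then f x0 else norm (x - x0) powr (- \<eta>) * (norm (x - x0) powr \<eta> * f x))"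
  proof
    fix x
    show "f x = (if x \<in> {x0} then f x0 else norm (x - x0) powr (- \<eta>) * (norm (x - x0) powr \<eta> * f x))"
    proof (cases "x = x0")
      case False
      then have "norm (x - x0) powr (- \<eta>) * norm (x - x0) powr \<eta> = 1"
        by (simp flip: powr_add)
      then show ?thesis using False by (simp flip: mult.assoc)
    qed simp
  qed
  moreover have "\<dots> \<in> borel_measurable lebesgue" by measurable
  ultimately show ?thesis by simp
qed

theorem corollary1p9:
  fixes \<Omega> :: "(real ^ 'n) set"
    and p p' q :: "real ^ 'n \<Rightarrow> real"
    and \<alpha> \<eta> :: real
    and x0 :: "real ^ 'n"
  assumes "bounded \<Omega>"
    and "\<Omega> \<in> sets lebesgue"
    and "0 \<le> \<alpha>"
    and "\<alpha> < real CARD('n)"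
    and "exponent_on \<Omega> p"
    and "log_Hoelder_on \<Omega> p"
    and "1 < exp_inf \<Omega> p"
    and "exp_sup \<Omega> p < (if \<alpha> = 0 then \<infinity> else ereal (real CARD('n) / \<alpha>))"
    and "\<forall>x\<in>\<Omega>. 1 / p x + 1 / p' x = 1"
    and "\<forall>x\<in>\<Omega>. 1 / q x = 1 / p x - \<alpha> / real CARD('n)"
    and "x0 \<in> \<Omega>"
    and "- (real CARD('n) / q x0) < \<eta>"
    and "\<eta> < real CARD('n) / p' x0"
  shows "\<exists>C>0. \<forall>f :: real ^ 'n \<Rightarrow> real.
           (\<lambda>x. power_weight x0 \<eta> x * f x) \<in> Lp_var p \<Omega> \<longrightarrow>
           lux_norm q \<Omega> (\<lambda>x. ennreal (power_weight x0 \<eta> x) * frac_maximal \<alpha> f x)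
             \<le> ennreal C * lux_norm p \<Omega> (\<lambda>x. ennreal \<bar>power_weight x0 \<eta> x * f x\<bar>)"
proof -
  define n where "n = real CARD('n)"
  have n1: "1 \<le> n" by (simp add: n_def)
  \<comment> \<open>The maximal theorem is applied in \<open>L\<^sup>s\<close>, which is why \<open>p\<close> has to stay away from \<open>1\<close>.\<close>
  obtain s where s: "1 < ereal s" "ereal s < exp_inf \<Omega> p"
    using ereal_dense2[OF assms(7)] by blast
  have p_ge: "s \<le> p x" if "x \<in> \<Omega>" for x
  proof -
    have "exp_inf \<Omega> p \<le> ereal (p x)" unfolding exp_inf_def using that by (rule INF_lower)
    with s(2) have "ereal s < ereal (p x)" by (rule less_le_trans)
    then show ?thesis by simp
  qed
  have sup_ge: "ereal (p x) \<le> exp_sup \<Omega> p" if "x \<in> \<Omega>" for x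
    unfolding exp_sup_def using that by (rule SUP_upper)
  have "exp_sup \<Omega> p \<noteq> \<infinity>" using assms(8) by auto
  moreover have "exp_sup \<Omega> p \<noteq> - \<infinity>" using sup_ge[OF assms(11)] by auto
  ultimately obtain P where P: "exp_sup \<Omega> p = ereal P" by (cases "exp_sup \<Omega> p") auto
  have p_le: "p x \<le> P" if "x \<in> \<Omega>" for x using sup_ge[OF that] P by simp
  have s1: "1 < s" using s(1) by (simp flip: one_ereal_def)
  have P1: "1 < P" using p_le[OF assms(11)] p_ge[OF assms(11)] s1 by simp
  define \<kappa> where "\<kappa> = 1 / P - \<alpha> / n"
  have \<kappa>: "0 < \<kappa>"
  proof (cases "\<alpha> = 0")
    case True
    then show ?thesis using P1 by (simp add: \<kappa>_def)
  next
    case False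
    then have "P < n / \<alpha>" using assms(8) P by (simp add: n_def)
    then have "P * \<alpha> < n" using False assms(3) by (simp add: field_simps)
    then show ?thesis using P1 n1 by (simp add: \<kappa>_def field_simps)
  qed
  define Q where "Q = 1 / \<kappa>"
  have q_inv: "\<kappa> \<le> 1 / q x" "1 / q x = 1 / p x - \<alpha> / n" if x: "x \<in> \<Omega>" for x
  proof -
    show eq: "1 / q x = 1 / p x - \<alpha> / n" using assms(10) x by (simp add: n_def)
    have "1 / P \<le> 1 / p x" using p_le[OF x] p_ge[OF x] s1 by (intro divide_left_mono) auto
    then show "\<kappa> \<le> 1 / q x" unfolding eq \<kappa>_def by simp
  qed
  have q_pos: "0 < q x" if "x \<in> \<Omega>" for x
    using q_inv(1)[OF that] \<kappa> by (smt (verit) divide_nonneg_nonpos)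
  have q_le: "q x \<le> Q" if "x \<in> \<Omega>" for x
    using q_inv(1)[OF that] q_pos[OF that] \<kappa> by (simp add: Q_def field_simps)
  obtain K where K: "log_Hoelder_bound \<Omega> p K"
  proof (rule log_Hoelder_on_imp_bound[OF assms(6), of P])
    show "0 \<le> p x \<and> p x \<le> P" if "x \<in> \<Omega>" for x using p_ge[OF that] p_le[OF that] s1 by simp
  qed
  have Kq: "log_Hoelder_bound \<Omega> q (K powr (Q * Q))"
  proof (rule log_Hoelder_bound_transfer[OF K])
    fix x y assume xy: "x \<in> \<Omega>" "y \<in> \<Omega>"
    have px: "1 < p x" "1 < p y" using p_ge s1 xy by (auto intro: less_le_trans)
    note qx = q_pos[OF xy(1)] q_pos[OF xy(2)]
    \<comment> \<open>The Lipschitz constant \<open>Q\<^sup>2\<close> arises because \<open>1 / q\<close> and \<open>1 / p\<close> differ by a constant and \<open>1 \<le> p\<close>.\<close>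
    have "q x - q y = q x * q y * (1 / q y - 1 / q x)" using qx by (simp add: field_simps)
    also have "1 / q y - 1 / q x = (p x - p y) / (p x * p y)"
      using px unfolding q_inv(2)[OF xy(1)] q_inv(2)[OF xy(2)] by (simp add: field_simps)
    finally have "\<bar>q x - q y\<bar> = q x * q y * (\<bar>p x - p y\<bar> / (p x * p y))"
      using qx px by (simp add: abs_mult)
    also have "\<dots> \<le> Q * Q * \<bar>p x - p y\<bar>"
    proof (intro mult_mono)
      have "1 \<le> p x * p y" using px by (simp add: mult_ge1_I)
      then have "\<bar>p x - p y\<bar> / (p x * p y) \<le> \<bar>p x - p y\<bar> / 1" using px by (intro divide_left_mono) auto
      then show "\<bar>p x - p y\<bar> / (p x * p y) \<le> \<bar>p x - p y\<bar>" by simp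
    qed (use qx q_le xy px in \<open>auto intro: less_imp_le order_trans[OF less_imp_le]\<close>)
    finally show "\<bar>q x - q y\<bar> \<le> Q * Q * \<bar>p x - p y\<bar>" .
  qed simp
  define K' where "K' = max K (K powr (Q * Q))"
  obtain b where b: "\<And>x. x \<in> \<Omega> \<Longrightarrow> norm x \<le> b" using assms(1) by (auto simp: bounded_iff)
  define D where "D = max 1 (2 * b)"
  interpret PW: power_weight_exponents \<Omega> p q \<alpha> s P Q K' D x0 \<eta>
  proof unfold_locales
    show "p \<in> borel_measurable (lebesgue_on \<Omega>)" using assms(5) by (simp add: exponent_on_def)
    show "log_Hoelder_bound \<Omega> p K'" by (rule log_Hoelder_bound_mono[OF K]) (simp add: K'_def)
    show "log_Hoelder_bound \<Omega> q K'" by (rule log_Hoelder_bound_mono[OF Kq]) (simp add: K'_def)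
    show "norm (x - y) \<le> D" if "x \<in> \<Omega>" "y \<in> \<Omega>" for x y
      using norm_triangle_ineq4[of x y] b[OF that(1)] b[OF that(2)] by (simp add: D_def)
    show "1 / q x = 1 / p x - \<alpha> / real DIM((real, 'n) vec)" if "x \<in> \<Omega>" for x
      using q_inv(2)[OF that] by (simp add: n_def)
    show "- (real DIM((real, 'n) vec) / q x0) < \<eta>" using assms(12) by simp
    have "1 / p' x0 = 1 - 1 / p x0" using assms(9,11) by (simp add: algebra_simps)
    then have "n * (1 / p' x0) = n - n / p x0" by (simp add: right_diff_distrib)
    then show "\<eta> < real DIM((real, 'n) vec) - real DIM((real, 'n) vec) / p x0"
      using assms(13) by (simp add: n_def)
  qed (use assms s1 p_ge p_le q_pos q_le in \<open>auto simp: D_def\<close>)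
  obtain L where L: "1 \<le> L" and modular_le:
    "\<And>g f. \<lbrakk>PW.unit_modular g; \<And>y. g y = PW.w y * \<bar>f y\<bar>; f \<in> borel_measurable lebesgue\<rbrakk> \<Longrightarrow>
      (\<integral>\<^sup>+x\<in>\<Omega>. ennreal_powr (ennreal (PW.w x) * frac_maximal_ball \<alpha> f x) (q x) / ennreal L \<partial>lebesgue) \<le> 1"
    using PW.weighted_ball_maximal_modular by blast
  \<comment> \<open>The factor \<open>n powr n\<close> pays for the passage from cubes to balls.  The factor \<open>L\<close> brings the modular
    below \<open>1\<close>, because \<open>(z / L)\<^sup>q \<le> z\<^sup>q / L\<close> for \<open>q \<ge> 1\<close> and \<open>L \<ge> 1\<close>.\<close>
  define C where "C = n powr n * L"
  have C0: "0 < C" using n1 L by (simp add: C_def)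
  have w_eq: "power_weight x0 \<eta> y = PW.w y" for y by (simp add: power_weight_def PW.w_def)
  have frac_le: "frac_maximal \<alpha> f x \<le> ennreal (n powr n * l) * frac_maximal_ball \<alpha> (\<lambda>y. f y / l) x"
    if "f \<in> borel_measurable lebesgue" "0 < l" for f :: "real ^ 'n \<Rightarrow> real" and x and l :: real
    using frac_maximal_le_frac_maximal_ball[OF assms(3) n_def, of f x] that
    by (simp add: frac_maximal_ball_divide[OF that] ennreal_mult'' mult.assoc)
  have modular_le_1: "modular q \<Omega> (\<lambda>x. ennreal (PW.w x) * frac_maximal \<alpha> f x / ennreal (C * l)) \<le> 1"
    if wf: "(\<lambda>x. PW.w x * f x) \<in> Lp_var p \<Omega>"
      and l: "0 < l" "modular p \<Omega> (\<lambda>x. ennreal \<bar>PW.w x * f x\<bar> / ennreal l) \<le> 1" for f and l :: real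
  proof -
    have wf_meas[measurable]: "(\<lambda>x. PW.w x * f x) \<in> borel_measurable lebesgue"
      and wf0: "\<And>x. x \<notin> \<Omega> \<Longrightarrow> PW.w x * f x = 0"
      using wf by (auto simp: Lp_var_def)
    have f[measurable]: "f \<in> borel_measurable lebesgue"
      using wf_meas unfolding PW.w_def by (rule borel_measurable_of_power_weight)
    define g where "g y = PW.w y * \<bar>f y / l\<bar>" for y
    have g_eq: "g y = \<bar>PW.w y * f y\<bar> / l" for y
      using l by (simp add: g_def PW.w_def abs_mult)
    have "PW.unit_modular g"
      unfolding PW.unit_modular_def
    proof (intro conjI allI impI)
      show "g \<in> borel_measurable lebesgue" unfolding g_eq by measurable
      show "0 \<le> g y" for y using l by (simp add: g_eq)
      show "g y = 0" if "y \<notin> \<Omega>" for y using wf0[OF that] by (simp add: g_eq)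
      have "(\<integral>\<^sup>+y\<in>\<Omega>. ennreal (g y powr p y) \<partial>lebesgue) = modular p \<Omega> (\<lambda>x. ennreal \<bar>PW.w x * f x\<bar> / ennreal l)"
        unfolding modular_def using l(1) by (simp add: divide_ennreal ennreal_powr_def g_eq)
      then show "(\<integral>\<^sup>+y\<in>\<Omega>. ennreal (g y powr p y) \<partial>lebesgue) \<le> 1" using l(2) by simp
    qed
    then have mod: "(\<integral>\<^sup>+x\<in>\<Omega>. ennreal_powr (ennreal (PW.w x) * frac_maximal_ball \<alpha> (\<lambda>y. f y / l) x) (q x) / ennreal L \<partial>lebesgue) \<le> 1"
      by (rule modular_le) (simp_all add: g_def)
    have "modular q \<Omega> (\<lambda>x. ennreal (PW.w x) * frac_maximal \<alpha> f x / ennreal (C * l))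
       \<le> (\<integral>\<^sup>+x\<in>\<Omega>. ennreal_powr (ennreal (PW.w x) * frac_maximal_ball \<alpha> (\<lambda>y. f y / l) x) (q x) / ennreal L \<partial>lebesgue)"
      unfolding modular_def
    proof (rule nn_integral_mono)
      fix x
      define N where "N = ennreal (PW.w x) * frac_maximal_ball \<alpha> (\<lambda>y. f y / l) x"
      have "ennreal_powr (ennreal (PW.w x) * frac_maximal \<alpha> f x / ennreal (C * l)) (q x) \<le> ennreal_powr N (q x) / ennreal L"
        if x: "x \<in> \<Omega>"
      proof -
        have nl: "0 < n powr n * l" using n1 l by simp
        have "ennreal (PW.w x) * frac_maximal \<alpha> f x / ennreal (C * l)
           \<le> ennreal (PW.w x) * (ennreal (n powr n * l) * frac_maximal_ball \<alpha> (\<lambda>y. f y / l) x) / ennreal (C * l)"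
          by (intro divide_right_mono_ennreal mult_left_mono frac_le f l) simp_all
        also have "\<dots> = N * (ennreal (n powr n * l) * inverse (ennreal (C * l)))"
          by (simp add: N_def divide_ennreal_def mult_ac)
        also have "ennreal (n powr n * l) * inverse (ennreal (C * l)) = inverse (ennreal L)"
          using nl L C0 l n1 by (simp add: inverse_ennreal ennreal_mult'[symmetric] C_def field_simps)
        also have "N * inverse (ennreal L) = N / ennreal L" by (simp add: divide_ennreal_def)
        finally have "ennreal_powr (ennreal (PW.w x) * frac_maximal \<alpha> f x / ennreal (C * l)) (q x)
            \<le> ennreal_powr (N / ennreal L) (q x)"
          using q_pos[OF x] by (intro ennreal_powr_mono) auto
        also have "\<dots> \<le> ennreal_powr N (q x) / ennreal L"
          using L PW.p_le_q[OF x] PW.p_gt_1[OF x] by (intro ennreal_powr_divide_le) auto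
        finally show ?thesis .
      qed
      then show "ennreal_powr (ennreal (PW.w x) * frac_maximal \<alpha> f x / ennreal (C * l)) (q x) * indicator \<Omega> x
        \<le> ennreal_powr (ennreal (PW.w x) * frac_maximal_ball \<alpha> (\<lambda>y. f y / l) x) (q x) / ennreal L * indicator \<Omega> x"
        unfolding N_def by (auto split: split_indicator)
    qed
    also have "\<dots> \<le> 1" by (rule mod)
    finally show ?thesis .
  qed
  show ?thesis
  proof (intro exI[of _ C] conjI C0 allI impI)
    fix f :: "real ^ 'n \<Rightarrow> real"
    assume wf: "(\<lambda>x. power_weight x0 \<eta> x * f x) \<in> Lp_var p \<Omega>"
    then show "lux_norm q \<Omega> (\<lambda>x. ennreal (power_weight x0 \<eta> x) * frac_maximal \<alpha> f x)
             \<le> ennreal C * lux_norm p \<Omega> (\<lambda>x. ennreal \<bar>power_weight x0 \<eta> x * f x\<bar>)"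
      unfolding w_eq by (intro lux_norm_le_mult[OF C0] modular_le_1)
  qed
qed

end
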